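(* Assume $\mathbb{E}[V(yZ_T^0)]<\infty$ for every $y>0$. Then for every $x_0\in(0,\infty)$ there exists $\hat f\in\mathcal C(x_0)$ such that $u(x_0,U)=\mathbb{E}[U(\hat f)]$.
   Context: Fix $T>0$ and a filtered probability space $(\Omega,\mathcal F,(\mathcal F_t)_{0\le t\le T},\mathbf P)$ satisfying the usual conditions. Fix $0<\lambda<1$ and a strictly positive càdlàg adapted stock price $S$ with ask price $S_t$ and bid price $(1-\lambda)S_t$. A $\lambda$-consistent price system is a strictly positive process $Z=(Z^0,Z^1)$ with $Z^0_0=1$, $Z^0$ a $\mathbf P$-martingale, $Z^1$ a $\mathbf P$-local martingale, and $Z^1_t/Z^0_t\in[(1-\lambda)S_t,S_t]$ a.s. for all $t$. Standing assumption: one such $Z$ is fixed, and $\mathbf Q$ denotes the probability measure with $d\mathbf Q/d\mathbf P=Z_T^0$ (equivalent to $\mathbf P$). Following the paper (which works under this one fixed consistent price system), the set of attainable terminal liquidation values with initial capital $x>0$ is $\mathcal C(x)=\{f\in L^0_+(\mathbf P):\mathbb{E}[Z_T^0 f]\le x\}$. A utility is a function $U:(0,\infty)\to\mathbb R$ that is non-constant, increasing, upper semicontinuous, with $U(\infty):=\lim_{x\to\infty}U(x)>0$ and satisfying the growth condition $\lim_{x\to\infty}U(x)/x=0$; $U$ is not assumed concave or differentiable. Set $U(0):=\lim_{x\downarrow 0}U(x)$ and $U:=-\infty$ on $(-\infty,0)$. For a random variable $f\ge 0$, $\mathbb{E}[U(f)]:=-\infty$ if $U^-(f)\notin L^1$.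 The value function is $u(x,U):=\sup\{\mathbb{E}[U(f)]: f\in\mathcal C(x)\}$. The convex conjugate of $U$ is $V(y):=\sup_{x>0}\{U(x)-xy\}$, $y>0$. *)

theory Defs
  imports "HOL-Probability.Probability"
begin

definition usc_pos :: "(real \<Rightarrow> real) \<Rightarrow> bool" where
  "usc_pos U \<longleftrightarrow> (\<forall>x>0. \<forall>c>U x. eventually (\<lambda>y. U y < c) (at x within {0<..}))"

(* A utility in the sense of the paper (no concavity/differentiability). U is only
   relevant on (0,oo). *)
definition utility :: "(real \<Rightarrow> real) \<Rightarrow> bool" where
  "utility U \<longleftrightarrow>
     (\<exists>x>0. \<exists>y>0. U x \<noteq> U y) \<and>
     mono_on {0<..} U \<and>
     usc_pos U \<and>
     ((\<lambda>x. ereal (U x)) \<longlongrightarrow> Sup ((\<lambda>x. ereal (U x)) ` {0<..})) at_top \<and>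
     Sup ((\<lambda>x. ereal (U x)) ` {0<..}) > 0 \<and>
     ((\<lambda>x. U x / x) \<longlongrightarrow> 0) at_top"

(* Extension of U: U(0) := lim_{x\<down>0} U x (possibly -oo, equal to the infimum since
   U is increasing), and U := -oo on (-oo,0). *)
definition Uext :: "(real \<Rightarrow> real) \<Rightarrow> real \<Rightarrow> ereal" where
  "Uext U x = (if x > 0 then ereal (U x)
               else if x = 0 then Lim (at_right 0) (\<lambda>t. ereal (U t))
               else -\<infinity>)"

definition ext_expectation :: "'a measure \<Rightarrow> ('a \<Rightarrow> ereal) \<Rightarrow> ereal" where
  "ext_expectation M g =
     (if g \<in> borel_measurable M \<and> (\<integral>\<^sup>+ w. e2ennreal (- g w) \<partial>M) < \<infinity>
      then enn2ereal (\<integral>\<^sup>+ w. e2ennreal (g w) \<partial>M) - enn2ereal (\<integral>\<^sup>+ w. e2ennreal (- g w) \<partial>M)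
      else -\<infinity>)"

(* C(x) = { f \<in> L^0_+ : E[Z f] \<le> x }, Z = Z_T^0 = dQ/dP. *)
definition attainable :: "'a measure \<Rightarrow> ('a \<Rightarrow> real) \<Rightarrow> real \<Rightarrow> ('a \<Rightarrow> real) set" where
  "attainable M Z x = {f. f \<in> borel_measurable M \<and> (\<forall>w\<in>space M. f w \<ge> 0) \<and>
                          (\<integral>\<^sup>+ w. ennreal (Z w * f w) \<partial>M) \<le> ennreal x}"

definition value_fun :: "'a measure \<Rightarrow> ('a \<Rightarrow> real) \<Rightarrow> (real \<Rightarrow> real) \<Rightarrow> real \<Rightarrow> ereal" where
  "value_fun M Z U x = (SUP f\<in>attainable M Z x. ext_expectation M (\<lambda>w. Uext U (f w)))"

definition conj_fun :: "(real \<Rightarrow> real) \<Rightarrow> real \<Rightarrow> ereal" where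
  "conj_fun U y = (SUP x\<in>{0<..}. ereal (U x - x * y))"

end

(*
  Along a maximizing sequence f_n one would like to pass to a limit, but U need not be concave, so
  neither convex combinations (Komlos) nor pointwise limits are available. Code the whole sequence
  by one real random variable \<phi>. On the countably many fibres of \<phi> with positive mass each f_n is
  constant, and a diagonal argument makes f_n converge there. Off these fibres \<phi> has no atoms, and
  one discards f_n, keeping only its limiting cost b: some multiplier c separates the costs of the
  pointwise maximizers of U(x) - c Z x into values below and above b, and switching from the smallest
  to the largest maximizer along {\<phi> \<le> t} hits b exactly. Fatou's lemma for the Lagrangian loss
  V(\<eta> Z) + \<eta> Z f_n - U(f_n), with multiplier \<eta> = c off the fibres and \<eta> = y on them, bounds the
  expected utility of the candidate from below, up to an error of order y. Finally y tends to 0.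
*)

theory Submission
  imports Defs "HOL-Complex_Analysis.Great_Picard"
begin

section \<open>Utilities and their conjugates\<close>

text \<open>Weak duality justifies discarding \<open>f_n\<close> off the fibres: a pointwise
  maximizer of the Lagrangian whose cost equals the limiting cost does at least as well as any
  competitor of that cost. On a fibre this fails: the maximizer may jump across the budget at the
  critical multiplier, and sets {\<phi> \<le> t} cannot cut the fibre in two, so the limit of
  \<open>f_n\<close> itself is kept. The cost of that limit can be smaller than the limit of the
  costs, and the lost amount is charged at the multiplier in force; hence a separate multiplier y on
  the fibres, free to tend to 0. This uses integrability of V(yZ) for arbitrarily small y; comparing
  V(yZ) with V(yZ/2) also bounds the cost of the maximizers. Two degenerate situations shape the
  statements. The critical multiplier can be 0, when \<open>U\<close> attains its supremum and the
  budget need not be exhausted; only complementary slackness survives. And a limiting cost b = 0 may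
  admit no finite multiplier; then \<open>f_n\<close> itself tends to 0 off the fibres along a
  subsequence.\<close>

lemma utility_mono: "utility U \<Longrightarrow> 0 < x \<Longrightarrow> x \<le> y \<Longrightarrow> U x \<le> U y"
  by (auto simp: utility_def mono_on_def)

lemma Uext_pos [simp]: "0 < x \<Longrightarrow> Uext U x = ereal (U x)"
  by (simp add: Uext_def)

lemma Uext_neg [simp]: "x < 0 \<Longrightarrow> Uext U x = -\<infinity>"
  by (simp add: Uext_def)

lemma Uext_0:
  assumes "utility U"
  shows "Uext U 0 = (INF x\<in>{0<..}. ereal (U x))"
proof -
  have "((\<lambda>t. ereal (U t)) \<longlongrightarrow> (INF x\<in>{0<..}. ereal (U x))) (at_right 0)"
  proof (rule order_tendstoI)
    fix a :: ereal
    assume a: "a < (INF x\<in>{0<..}. ereal (U x))"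
    show "\<forall>\<^sub>F t in at_right 0. a < ereal (U t)"
      unfolding eventually_at_right_field
      by (intro exI[of _ 1]) (use a in \<open>auto intro: less_le_trans INF_lower\<close>)
  next
    fix a :: ereal
    assume "(INF x\<in>{0<..}. ereal (U x)) < a"
    then obtain x where "0 < x" "ereal (U x) < a"
      by (auto simp: INF_less_iff)
    then show "\<forall>\<^sub>F t in at_right 0. ereal (U t) < a"
      unfolding eventually_at_right_field
      by (intro exI[of _ x] conjI allI impI le_less_trans[OF _ \<open>ereal (U x) < a\<close>])
        (auto intro: utility_mono[OF assms])
  qed
  then show ?thesis
    by (simp add: Uext_def tendsto_Lim)
qed

lemma mono_Uext:
  assumes "utility U"
  shows "mono (Uext U)"
proof (rule monoI)
  fix x y :: real
  assume "x \<le> y"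
  then consider "x < 0" | "x = 0" "y = 0" | "x = 0" "0 < y" | "0 < x" "0 < y"
    by linarith
  then show "Uext U x \<le> Uext U y"
    using utility_mono[OF assms _ \<open>x \<le> y\<close>]
    by cases (auto simp: Uext_0[OF assms] intro: INF_lower)
qed

lemma Uext_less_top:
  assumes "utility U"
  shows "Uext U x < \<infinity>"
proof -
  have "Uext U x \<le> Uext U (max x 1)"
    by (rule monoD[OF mono_Uext[OF assms]]) simp
  also have "\<dots> < \<infinity>" by simp
  finally show ?thesis .
qed

text \<open>For an increasing function, upper semicontinuity amounts to right continuity.\<close>

lemma Uext_right_less:
  assumes "utility U" "0 \<le> x" "Uext U x < c"
  obtains x' where "x < x'" "Uext U x' < c"
proof (cases "x = 0")
  case True
  with assms obtain x' where "0 < x'" "ereal (U x') < c"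
    by (auto simp: Uext_0 INF_less_iff)
  then show ?thesis using that True by auto
next
  case False
  then have x: "0 < x" using assms by simp
  show ?thesis
  proof (cases "c = \<infinity>")
    case True
    then show ?thesis using that[of "x + 1"] x by simp
  next
    case False
    then obtain r where r: "c = ereal r"
      using assms(3) by (cases c) auto
    have "\<forall>\<^sub>F y in at x within {0<..}. U y < r"
      using assms x r by (auto simp: utility_def usc_pos_def)
    then obtain d where d: "0 < d" "\<And>y. 0 < y \<Longrightarrow> y \<noteq> x \<Longrightarrow> dist y x < d \<Longrightarrow> U y < r"
      by (auto simp: eventually_at)
    show ?thesis
      using that[of "x + d / 2"] d(2)[of "x + d / 2"] d(1) x r by (auto simp: dist_real_def)
  qed
qed

text \<open>Right continuity gives a point x' > x whose utility is still below \<open>c\<close>;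
  monotonicity then controls every value of the sequence below x', on either side of
  \<open>x\<close>.\<close>

lemma Uext_limsup:
  assumes U: "utility U" and x: "X \<longlonglongrightarrow> x" "0 \<le> x"
  shows "limsup (\<lambda>n. Uext U (X n)) \<le> Uext U x"
proof (rule dense_ge)
  fix c assume "Uext U x < c"
  then obtain x' where x': "x < x'" "Uext U x' < c"
    using Uext_right_less[OF U x(2)] by metis
  have "\<forall>\<^sub>F n in sequentially. Uext U (X n) \<le> c"
    using order_tendstoD(2)[OF x(1) x'(1)]
  proof eventually_elim
    case (elim n)
    then have "Uext U (X n) \<le> Uext U x'"
      by (intro monoD[OF mono_Uext[OF U]]) simp
    then show ?case using x'(2) by simp
  qed
  then show "limsup (\<lambda>n. Uext U (X n)) \<le> c"
    by (rule Limsup_bounded)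
qed

section \<open>Fenchel's inequality and its equality case\<close>

lemma conj_fun_ge: "0 < x \<Longrightarrow> ereal (U x - x * y) \<le> conj_fun U y"
  unfolding conj_fun_def by (rule SUP_upper) simp

lemma conj_fun_antimono: "y \<le> y' \<Longrightarrow> conj_fun U y' \<le> conj_fun U y"
  unfolding conj_fun_def
  by (rule SUP_mono) (metis ereal_less_eq(3) diff_left_mono greaterThan_iff less_imp_le mult_left_mono)

lemma conj_fun_gt_bot: "- \<infinity> < conj_fun U y"
  using conj_fun_ge[of 1 U y] by (auto intro: less_le_trans)

lemma Uext_le_conj:
  assumes U: "utility U" and "0 \<le> x" "0 \<le> y"
  shows "Uext U x \<le> conj_fun U y + ereal (x * y)"
proof (cases "x = 0")
  case False
  then have "ereal (U x - x * y) + ereal (x * y) \<le> conj_fun U y + ereal (x * y)"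
    using assms by (intro add_right_mono conj_fun_ge) simp
  then show ?thesis using False assms by simp
next
  case True
  have "Uext U 0 \<le> conj_fun U y"
  proof (rule ereal_le_epsilon2)
    fix e :: real assume e: "0 < e"
    \<comment> \<open>The supremum in \<open>conj_fun\<close> omits 0, so the bound there is
      approached from the right. The added 1 covers y = 0.\<close>
    define t where "t = e / (y + 1)"
    have t: "0 < t" "t * y \<le> e"
      using e \<open>0 \<le> y\<close> by (auto simp: t_def field_simps)
    have "Uext U 0 \<le> ereal (U t)"
      using t by (auto simp: Uext_0[OF U] intro: INF_lower)
    also have "\<dots> = ereal (U t - t * y) + ereal (t * y)" by simp
    also have "\<dots> \<le> conj_fun U y + ereal e"
      using t by (intro add_mono conj_fun_ge) auto
    finally show "Uext U 0 \<le> conj_fun U y + ereal e" .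
  qed
  then show ?thesis using True by simp
qed

lemma utility_sublinear:
  assumes U: "utility U" and "0 < e"
  obtains K where "0 < K" "\<And>x. K \<le> x \<Longrightarrow> U x \<le> e * x"
proof -
  have "\<forall>\<^sub>F x in at_top. U x / x < e"
    using U \<open>0 < e\<close> by (auto simp: utility_def dest: order_tendstoD(2))
  then obtain K where K: "\<And>x. K \<le> x \<Longrightarrow> U x / x < e"
    by (auto simp: eventually_at_top_linorder)
  show ?thesis
  proof
    show "0 < max K 1" by simp
    fix x assume "max K 1 \<le> x"
    then show "U x \<le> e * x" using K[of x] by (auto simp: field_simps)
  qed
qed

text \<open>Sublinear growth makes \<open>U x - x * y\<close> nonpositive beyond some K, and
  monotonicity bounds it by \<open>U K\<close> before.\<close>

lemma conj_fun_less_top: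
  assumes U: "utility U" and y: "0 < y"
  shows "conj_fun U y < \<infinity>"
proof -
  obtain K where K: "0 < K" "\<And>x. K \<le> x \<Longrightarrow> U x \<le> y * x"
    using utility_sublinear[OF U y] by metis
  have "conj_fun U y \<le> ereal (max (U K) 0)"
    unfolding conj_fun_def
  proof (rule SUP_least)
    fix x :: real assume "x \<in> {0<..}"
    then have x: "0 < x" by simp
    show "ereal (U x - x * y) \<le> ereal (max (U K) 0)"
    proof (cases "K \<le> x")
      case True
      then show ?thesis using K(2)[OF True] by (simp add: mult.commute max_def)
    next
      case False
      then have "U x \<le> U K" using utility_mono[OF U x, of K] by simp
      moreover have "0 < x * y" using x y by simp
      ultimately show ?thesis by (auto simp: max_def)
    qed
  qed
  also have "\<dots> < \<infinity>" by (simp add: max_def)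
  finally show ?thesis .
qed

lemma conj_fun_real:
  assumes "utility U" "0 < y"
  shows "ereal (real_of_ereal (conj_fun U y)) = conj_fun U y"
  using conj_fun_less_top[OF assms] conj_fun_gt_bot[of U y]
  by (cases "conj_fun U y") auto

text \<open>A supremum of affine functions is lower semicontinuous. This includes y = 0, where the
  conjugate may be infinite.\<close>

lemma conj_fun_liminf:
  assumes "Y \<longlonglongrightarrow> y"
  shows "conj_fun U y \<le> liminf (\<lambda>n. conj_fun U (Y n))"
  unfolding conj_fun_def[of U y]
proof (rule SUP_least)
  fix x :: real assume x: "x \<in> {0<..}"
  have "(\<lambda>n. ereal (U x - x * Y n)) \<longlonglongrightarrow> ereal (U x - x * y)"
    by (intro tendsto_intros assms)
  then have "ereal (U x - x * y) = liminf (\<lambda>n. ereal (U x - x * Y n))"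
    by (intro lim_imp_Liminf[symmetric]) simp_all
  also have "\<dots> \<le> liminf (\<lambda>n. conj_fun U (Y n))"
    using x by (intro Liminf_mono always_eventually allI conj_fun_ge) simp
  finally show "ereal (U x - x * y) \<le> liminf (\<lambda>n. conj_fun U (Y n))" .
qed

text \<open>Equality in Fenchel's inequality. For a utility, \<open>Uext\<close> never takes the
  value \<infinity>, so the relation forces \<open>conj_fun U y\<close> below \<infinity>, which is
  genuine information at y = 0.\<close>

definition conj_opt :: "(real \<Rightarrow> real) \<Rightarrow> real \<Rightarrow> real \<Rightarrow> bool" where
  "conj_opt U y x \<longleftrightarrow> 0 \<le> x \<and> Uext U x + ereal (- (x * y)) = conj_fun U y"

lemma conj_optI:
  assumes U: "utility U" and "0 \<le> x" "0 \<le> y" "conj_fun U y \<le> Uext U x + ereal (- (x * y))"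
  shows "conj_opt U y x"
proof -
  have "Uext U x + ereal (- (x * y)) \<le> conj_fun U y"
    using add_right_mono[OF Uext_le_conj[OF U assms(2,3)], of "ereal (- (x * y))"]
    by (cases "conj_fun U y"; cases "Uext U x") auto
  with assms show ?thesis by (simp add: conj_opt_def)
qed

text \<open>The maximizer relation has a closed graph because \<open>Uext\<close> is upper
  semicontinuous. The sequence \<open>A\<close> admits approximate maximizers too: in
  \<open>conj_opt_exists\<close> it increases to the supremum at a fixed slope, in
  \<open>optimal_allocation\<close> it is the conjugate along moving slopes.\<close>

lemma conj_opt_limit:
  assumes U: "utility U" and Y: "Y \<longlonglongrightarrow> y" "0 \<le> y" and X: "X \<longlonglongrightarrow> x" "0 \<le> x"
    and le: "\<And>n. A n \<le> Uext U (X n) + ereal (- (X n * Y n))"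
    and lim: "conj_fun U y \<le> liminf A"
  shows "conj_opt U y x"
proof (rule conj_optI[OF U X(2) Y(2)])
  have "(\<lambda>n. ereal (- (X n * Y n))) \<longlonglongrightarrow> ereal (- (x * y))"
    by (intro tendsto_intros X Y)
  then have l: "limsup (\<lambda>n. ereal (- (X n * Y n))) = ereal (- (x * y))"
    by (simp add: lim_imp_Limsup)
  have "conj_fun U y \<le> limsup A"
    using lim Liminf_le_Limsup[of sequentially A] by simp
  also have "\<dots> \<le> limsup (\<lambda>n. Uext U (X n) + ereal (- (X n * Y n)))"
    by (intro Limsup_mono always_eventually allI le)
  also have "\<dots> \<le> limsup (\<lambda>n. Uext U (X n)) + limsup (\<lambda>n. ereal (- (X n * Y n)))"
    using Uext_limsup[OF U X] Uext_less_top[OF U, of x]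
    by (intro ereal_limsup_add_mono)
  also have "\<dots> \<le> Uext U x + ereal (- (x * y))"
    unfolding l by (intro add_right_mono Uext_limsup U X)
  finally show "conj_fun U y \<le> Uext U x + ereal (- (x * y))" .
qed

lemma conj_opt_exists:
  assumes U: "utility U" and y: "0 < y"
  shows "\<exists>x. conj_opt U y x"
proof -
  let ?g = "\<lambda>x. ereal (U x - x * y)"
  have "\<exists>f. range f \<subseteq> ?g ` {0<..} \<and> conj_fun U y = (SUP i::nat. f i) \<and> incseq f"
    unfolding conj_fun_def using Sup_countable_SUP[of "?g ` {0<..}"] by auto
  then obtain f :: "nat \<Rightarrow> ereal" where f: "range f \<subseteq> ?g ` {0<..}" "conj_fun U y = (SUP i. f i)" "incseq f"
    by blast
  then have "\<forall>n. \<exists>x>0. f n = ?g x" by auto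
  then obtain X where X: "\<And>n. 0 < X n" "\<And>n. f n = ?g (X n)"
    by metis
  have flim: "f \<longlonglongrightarrow> conj_fun U y"
    using f LIMSEQ_SUP[of f] by simp
  \<comment> \<open>Half the slope leaves a term -(y/2) x, which makes the objective coercive;
    comparison with the first element of the sequence then gives the second entry of
    \<open>B\<close>.\<close>
  obtain K where K: "0 < K" "\<And>x. K \<le> x \<Longrightarrow> U x \<le> y / 2 * x"
    using utility_sublinear[OF U, of "y / 2"] y by auto
  define B where "B = max K (2 / y * (X 0 * y - U (X 0)))"
  have bnd: "X n \<le> B" for n
  proof (cases "K \<le> X n")
    case True
    have "f 0 \<le> f n" using f(3) by (auto simp: incseq_def)
    then have "U (X 0) - X 0 * y \<le> U (X n) - X n * y" by (simp add: X)
    also have "\<dots> \<le> - (y / 2 * X n)" using K(2)[OF True] by (simp add: mult.commute)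
    finally have "X n \<le> 2 / y * (X 0 * y - U (X 0))" using y by (simp add: field_simps)
    then show ?thesis by (simp add: B_def)
  qed (simp add: B_def)
  have "\<forall>n. X n \<in> {0..B}" using bnd X(1) by (auto intro: less_imp_le)
  then obtain x r where xr: "x \<in> {0..B}" "strict_mono r" "(X \<circ> r) \<longlonglongrightarrow> x"
    using compact_Icc[of 0 B] unfolding compact_def by metis
  have "conj_opt U y x"
  proof (rule conj_opt_limit[OF U, where Y = "\<lambda>_. y" and X = "X \<circ> r" and A = "f \<circ> r"])
    show "conj_fun U y \<le> liminf (f \<circ> r)"
      using LIMSEQ_subseq_LIMSEQ[OF flim xr(2)] by (simp add: lim_imp_Liminf)
  qed (use xr X y in auto)
  then show ?thesis ..
qed

lemma conj_opt_real:
  assumes U: "utility U" and "0 < y" "conj_opt U y x"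
  obtains w where "Uext U x = ereal w" "conj_fun U y = ereal (w - x * y)"
  using assms conj_fun_real[OF U \<open>0 < y\<close>]
  by (cases "Uext U x"; cases "conj_fun U y") (auto simp: conj_opt_def)

text \<open>Test each maximizer in the Fenchel inequality of the other slope and add. Without
  concavity this orders any two choices of maximizers, provided the slopes differ.\<close>

lemma conj_opt_antimono:
  assumes U: "utility U" and y: "0 < y" "y < y'" and o: "conj_opt U y x" "conj_opt U y' x'"
  shows "x' \<le> x"
proof -
  have y': "0 < y'" using y by simp
  obtain w where w: "Uext U x = ereal w" "conj_fun U y = ereal (w - x * y)"
    using conj_opt_real[OF U y(1) o(1)] .
  obtain w' where w': "Uext U x' = ereal w'" "conj_fun U y' = ereal (w' - x' * y')"
    using conj_opt_real[OF U y' o(2)] .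
  have nn: "0 \<le> x" "0 \<le> x'" using o by (auto simp: conj_opt_def)
  have "w \<le> (w' - x' * y') + x * y'"
    using Uext_le_conj[OF U nn(1), of y'] w w' y' by simp
  moreover have "w' \<le> (w - x * y) + x' * y"
    using Uext_le_conj[OF U nn(2), of y] w w' y by simp
  ultimately have "(x' - x) * (y' - y) \<le> 0" by (simp add: algebra_simps)
  then show ?thesis using y by (simp add: mult_le_0_iff)
qed

text \<open>Fenchel's inequality at slope y/2, tested at a maximizer for y. It replaces a derivative
  of the conjugate and turns integrability of conjugates into integrability of costs.\<close>

lemma conj_opt_bound:
  assumes U: "utility U" and y: "0 < y" and o: "conj_opt U y x"
  shows "y / 2 * x \<le> real_of_ereal (conj_fun U (y / 2)) - real_of_ereal (conj_fun U y)"
proof -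
  obtain w where w: "Uext U x = ereal w" "conj_fun U y = ereal (w - x * y)"
    using conj_opt_real[OF U y o] .
  have "0 \<le> x" using o by (simp add: conj_opt_def)
  then have "ereal w \<le> conj_fun U (y / 2) + ereal (x * (y / 2))"
    using Uext_le_conj[OF U, of x "y / 2"] w y by simp
  then show ?thesis
    using w conj_fun_real[OF U, of "y / 2"] y by (cases "conj_fun U (y / 2)") (auto simp: algebra_simps)
qed

section \<open>Measure and integration\<close>

text \<open>Writes the expectation as a finite constant minus a nonnegative loss, so that Fatou's
  lemma applies to the loss. As g \<le> h, the positive part of \<open>g\<close> has finite
  integral, and the convention -\<infinity> for a non-integrable negative part corresponds exactly
  to infinite loss.\<close>

lemma ext_expectation_eq:
  assumes g: "g \<in> borel_measurable M" and h: "integrable M h"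
    and le: "\<And>w. w \<in> space M \<Longrightarrow> g w \<le> ereal (h w)"
  shows "ext_expectation M g =
    ereal (\<integral>w. h w \<partial>M) - enn2ereal (\<integral>\<^sup>+ w. e2ennreal (ereal (h w) - g w) \<partial>M)"
proof -
  define L where "L = (\<integral>\<^sup>+ w. e2ennreal (ereal (h w) - g w) \<partial>M)"
  define gp where "gp = (\<integral>\<^sup>+ w. e2ennreal (g w) \<partial>M)"
  define gm where "gm = (\<integral>\<^sup>+ w. e2ennreal (- g w) \<partial>M)"
  define hp where "hp = (\<integral>\<^sup>+ w. ennreal (h w) \<partial>M)"
  define hm where "hm = (\<integral>\<^sup>+ w. ennreal (- h w) \<partial>M)"
  have [measurable]: "h \<in> borel_measurable M" "g \<in> borel_measurable M" using g h by auto
  \<comment> \<open>The identity h - (h - g) = g with every term moved to the side where it is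
    nonnegative, so that no infinite quantities are subtracted before finiteness is known.\<close>
  have "e2ennreal (ereal (h w) - g w) + e2ennreal (g w) + ennreal (- h w) =
      ennreal (h w) + e2ennreal (- g w)" if "w \<in> space M" for w
  proof (cases "g w")
    case (real r)
    then have "r \<le> h w" using le[OF that] by simp
    with real show ?thesis
      by (cases "0 \<le> r"; cases "0 \<le> h w")
        (auto simp: ennreal_neg e2ennreal_ereal simp flip: ennreal_plus)
  qed (use le[OF that] in \<open>auto simp: e2ennreal_infty\<close>)
  then have "(\<integral>\<^sup>+ w. e2ennreal (ereal (h w) - g w) + e2ennreal (g w) + ennreal (- h w) \<partial>M) =
      (\<integral>\<^sup>+ w. ennreal (h w) + e2ennreal (- g w) \<partial>M)"
    by (rule nn_integral_cong)
  then have eq: "L + gp + hm = hp + gm"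
    unfolding L_def gp_def hm_def hp_def gm_def by (simp add: nn_integral_add)
  have fin: "hp < \<infinity>" "hm < \<infinity>"
    using h unfolding hp_def hm_def real_integrable_def by (auto simp: top.not_eq_extremum)
  have "gp \<le> hp"
    unfolding gp_def hp_def
  proof (rule nn_integral_mono)
    fix w assume "w \<in> space M"
    from e2ennreal_mono[OF le[OF this]] show "e2ennreal (g w) \<le> ennreal (h w)"
      by (simp add: e2ennreal_ereal)
  qed
  then have gp: "gp < \<infinity>" using fin by auto
  have hint: "(\<integral>w. h w \<partial>M) = enn2real hp - enn2real hm"
    unfolding hp_def hm_def by (rule real_lebesgue_integral_def[OF h])
  show ?thesis
  proof (cases "gm < \<infinity>")
    case True
    then have "L < \<infinity>" using eq fin gp
      by (metis ennreal_add_eq_top infinity_ennreal_def top.not_eq_extremum)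
    with True fin gp eq obtain l p m hp' hm' where r:
      "L = ennreal l" "gp = ennreal p" "gm = ennreal m" "hp = ennreal hp'" "hm = ennreal hm'"
      "0 \<le> l" "0 \<le> p" "0 \<le> m" "0 \<le> hp'" "0 \<le> hm'"
      by (metis ennreal_cases infinity_ennreal_def top.not_eq_extremum)
    then have "l + p + hm' = hp' + m" using eq by (simp flip: ennreal_plus)
    then have "ereal p - ereal m = ereal (hp' - hm') - ereal l" by simp
    then show ?thesis
      using True g r hint
      unfolding ext_expectation_def gp_def[symmetric] gm_def[symmetric] L_def[symmetric]
      by (simp add: enn2ereal_ennreal)
  next
    case False
    then have "L = \<infinity>" using eq fin gp
      by (metis ennreal_add_eq_top infinity_ennreal_def top.not_eq_extremum)
    then show ?thesis
      using False
      unfolding ext_expectation_def gp_def[symmetric] gm_def[symmetric] L_def[symmetric]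
      by simp
  qed
qed

lemma borel_measurable_mono_ereal:
  fixes f :: "real \<Rightarrow> ereal"
  assumes "mono f"
  shows "f \<in> borel_measurable borel"
  unfolding borel_measurable_ereal_iff_Ioi
proof
  fix a
  have "is_interval (f -` {a<..})"
    unfolding is_interval_1 using monoD[OF assms] by (auto intro: less_le_trans)
  then show "f -` {a<..} \<inter> space borel \<in> sets borel"
    by (simp add: real_interval_borel_measurable)
qed

lemma borel_measurable_antimono_ereal:
  fixes f :: "real \<Rightarrow> ereal"
  assumes "antimono f"
  shows "f \<in> borel_measurable borel"
  unfolding borel_measurable_ereal_iff_Ioi
proof
  fix a
  have "is_interval (f -` {a<..})"
    unfolding is_interval_1 using antimonoD[OF assms] by (auto intro: less_le_trans)
  then show "f -` {a<..} \<inter> space borel \<in> sets borel"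
    by (simp add: real_interval_borel_measurable)
qed

lemma conj_fun_measurable [measurable]: "conj_fun U \<in> borel_measurable borel"
  by (intro borel_measurable_antimono_ereal antimonoI conj_fun_antimono)

lemma integrable_piecewise:
  fixes f g :: "'a \<Rightarrow> real"
  assumes f: "integrable M f" and g: "integrable M g" and [measurable]: "A \<in> sets M"
  shows "integrable M (\<lambda>w. if w \<in> A then f w else g w)"
  by (rule Bochner_Integration.integrable_bound[OF
        Bochner_Integration.integrable_add[OF integrable_abs[OF f] integrable_abs[OF g]]])
    (use f g in auto)

lemma integral_fatou:
  fixes f :: "nat \<Rightarrow> 'a \<Rightarrow> real"
  assumes f: "\<And>n. integrable M (f n)" "\<And>n. AE w in M. 0 \<le> f n w"
    and [measurable]: "g \<in> borel_measurable M"
    and lim: "AE w in M. (\<lambda>n. f n w) \<longlonglongrightarrow> g w"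
    and le: "liminf (\<lambda>n. ennreal (\<integral>w. f n w \<partial>M)) \<le> ennreal b" "0 \<le> b"
  shows "integrable M g" "(\<integral>w. g w \<partial>M) \<le> b"
proof -
  have [measurable]: "f n \<in> borel_measurable M" for n using f(1) by auto
  have "AE w in M. \<forall>n. 0 \<le> f n w" using f(2) by (simp add: AE_all_countable)
  then have g_nn: "AE w in M. 0 \<le> g w"
    using lim by eventually_elim (auto intro: LIMSEQ_le_const)
  have "(\<integral>\<^sup>+ w. ennreal (g w) \<partial>M) = (\<integral>\<^sup>+ w. liminf (\<lambda>n. ennreal (f n w)) \<partial>M)"
  proof (rule nn_integral_cong_AE)
    show "AE w in M. ennreal (g w) = liminf (\<lambda>n. ennreal (f n w))"
      using lim by eventually_elim (auto intro!: lim_imp_Liminf[symmetric] tendsto_ennrealI)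
  qed
  also have "\<dots> \<le> liminf (\<lambda>n. \<integral>\<^sup>+ w. ennreal (f n w) \<partial>M)"
    by (intro nn_integral_liminf) simp
  also have "\<dots> \<le> ennreal b"
    using le(1) nn_integral_eq_integral[OF f] by simp
  finally have le_b: "(\<integral>\<^sup>+ w. ennreal (g w) \<partial>M) \<le> ennreal b" .
  then show i: "integrable M g"
    using g_nn by (intro integrableI_nonneg) (auto intro: le_less_trans)
  show "(\<integral>w. g w \<partial>M) \<le> b"
    using le_b le(2) nn_integral_eq_integral[OF i g_nn] by simp
qed

lemma AE_convergent_of_bounded_integrals:
  fixes X :: "nat \<Rightarrow> 'a \<Rightarrow> real"
  assumes X: "\<And>n. integrable M (X n)" and nn: "\<And>n w. w \<in> space M \<Longrightarrow> 0 \<le> X n w"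
    and inc: "\<And>n w. w \<in> space M \<Longrightarrow> X n w \<le> X (Suc n) w"
    and le: "\<And>n. (\<integral>w. X n w \<partial>M) \<le> b"
  shows "AE w in M. convergent (\<lambda>n. X n w)"
proof -
  have [measurable]: "X n \<in> borel_measurable M" for n using X by auto
  have "(\<integral>\<^sup>+ w. (SUP n. ennreal (X n w)) \<partial>M) = (SUP n. \<integral>\<^sup>+ w. ennreal (X n w) \<partial>M)"
    by (intro nn_integral_monotone_convergence_SUP_AE) (auto intro!: ennreal_leI inc)
  also have "\<dots> \<le> ennreal b"
    using le nn by (intro SUP_least) (auto simp: nn_integral_eq_integral[OF X] intro: ennreal_leI)
  finally have "AE w in M. (SUP n. ennreal (X n w)) \<noteq> \<infinity>"
    by (intro nn_integral_PInf_AE) (auto simp: top_unique)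
  then show ?thesis
    using AE_space
  proof eventually_elim
    case (elim w)
    have "X n w \<le> enn2real (SUP n. ennreal (X n w))" for n
    proof -
      have "ennreal (X n w) \<le> (SUP n. ennreal (X n w))" by (rule SUP_upper) simp
      then show ?thesis
        using elim nn[of w n] enn2real_mono[of "ennreal (X n w)" "SUP n. ennreal (X n w)"]
        by (metis enn2real_ennreal infinity_ennreal_def top.not_eq_extremum)
    qed
    moreover have "incseq (\<lambda>n. X n w)" using inc elim by (intro incseq_SucI) auto
    ultimately show ?case
      by (metis incseq_convergent convergentI)
  qed
qed

text \<open>Digits 0 and 1 in base 3, as in the Cantor set, avoid the ambiguity of binary
  expansions: everything after position k sums to at most half of (1/3)^k and cannot compensate a
  differing digit.\<close>

lemma ternary_expansion_inj:
  fixes b b' :: "nat \<Rightarrow> bool"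
  assumes eq: "(\<Sum>k. of_bool (b k) * (1/3) ^ k :: real) = (\<Sum>k. of_bool (b' k) * (1/3) ^ k)"
  shows "b k = b' k"
proof (induction k rule: less_induct)
  case (less k)
  define d :: "nat \<Rightarrow> real" where "d j = of_bool (b j) * (1/3) ^ j - of_bool (b' j) * (1/3) ^ j" for j
  have geom: "summable (\<lambda>j. (1/3::real) ^ j)" by simp
  have sb: "summable (\<lambda>j. of_bool (c j) * (1/3::real) ^ j)" for c :: "nat \<Rightarrow> bool"
    by (rule summable_comparison_test[OF _ geom]) (auto intro!: exI[of _ 0])
  have sd: "summable d" unfolding d_def by (intro summable_diff sb)
  have tail: "(\<Sum>j. d (j + Suc k)) = - d k"
  proof -
    have "(\<Sum>j. d j) = 0" using eq unfolding d_def by (subst suminf_diff[symmetric]) (auto intro: sb)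
    moreover have "(\<Sum>j<k. d j) = 0" using less by (intro sum.neutral) (auto simp: d_def)
    ultimately show ?thesis
      using suminf_split_initial_segment[OF sd, of "Suc k"] by simp
  qed
  have st: "summable (\<lambda>j. (1/3::real) ^ Suc k * (1/3) ^ j)"
    by (intro summable_mult geom)
  have bd: "norm (d (j + Suc k)) \<le> (1/3) ^ Suc k * (1/3) ^ j" for j
    by (auto simp: d_def power_add)
  have "\<bar>d k\<bar> \<le> (\<Sum>j. (1/3::real) ^ Suc k * (1/3) ^ j)"
    using norm_suminf_le[OF bd st] tail by simp
  also have "\<dots> = (1/3) ^ Suc k * (3/2)"
    by (subst suminf_mult[OF geom]) (simp add: suminf_geometric)
  also have "\<dots> < (1/3) ^ k" by simp
  finally show ?case by (cases "b k"; cases "b' k") (auto simp: d_def)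
qed

text \<open>The digits record the truth of \<open>X i w < q\<close> for all indices i and rationals
  q, which determines all values by density. A real code brings only countably many fibres of
  positive mass and ordered slices {\<phi> \<le> t}.\<close>

lemma countable_family_code:
  fixes X :: "nat \<Rightarrow> 'a \<Rightarrow> real"
  assumes [measurable]: "\<And>n. X n \<in> borel_measurable M"
  obtains \<phi> :: "'a \<Rightarrow> real" where "\<phi> \<in> borel_measurable M" "\<And>w. 0 \<le> \<phi> w" "\<And>w. \<phi> w \<le> 2"
    "\<And>n w w'. \<phi> w = \<phi> w' \<Longrightarrow> X n w = X n w'"
proof
  define b where "b k w \<longleftrightarrow> (case from_nat k of (i, q) \<Rightarrow> X i w < real_of_rat q)" for k w
  have [measurable]: "Measurable.pred M (b k)" for k
    unfolding b_def by (cases "from_nat k :: nat \<times> rat") simp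
  define \<phi> where "\<phi> w = (\<Sum>k. of_bool (b k w) * (1/3::real) ^ k)" for w
  have geom: "summable (\<lambda>j. (1/3::real) ^ j)" by simp
  have sb: "summable (\<lambda>j. of_bool (b j w) * (1/3::real) ^ j)" for w
    by (rule summable_comparison_test[OF _ geom]) (auto intro!: exI[of _ 0])
  show "\<phi> \<in> borel_measurable M" unfolding \<phi>_def of_bool_def by measurable
  show "0 \<le> \<phi> w" for w unfolding \<phi>_def by (intro suminf_nonneg sb) auto
  show "\<phi> w \<le> 2" for w
  proof -
    have "\<phi> w \<le> (\<Sum>k. (1/3::real) ^ k)" unfolding \<phi>_def by (intro suminf_le sb geom) auto
    also have "\<dots> \<le> 2" by (simp add: suminf_geometric)
    finally show ?thesis .
  qed
  show "X n w = X n w'" if "\<phi> w = \<phi> w'" for n w w'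
  proof -
    have bb: "b k w = b k w'" for k
      using ternary_expansion_inj[of "\<lambda>k. b k w" "\<lambda>k. b k w'"] that by (simp add: \<phi>_def)
    have "X n w < real_of_rat q \<longleftrightarrow> X n w' < real_of_rat q" for q
      using bb[of "to_nat (n, q)"] by (simp add: b_def)
    then show ?thesis
      using of_rat_dense[of "X n w" "X n w'"] of_rat_dense[of "X n w'" "X n w"]
      by (metis less_asym linorder_neqE_linordered_idom)
  qed
qed

text \<open>An explicit form of Lyapunov's convexity theorem: as no level set of \<phi> has mass in
  \<open>N\<close>, the integral over the slice depends continuously on t by dominated convergence,
  and the intermediate value theorem applies.\<close>

lemma integral_slice_intermediate:
  fixes h \<phi> :: "'a \<Rightarrow> real"
  assumes [measurable]: "\<phi> \<in> borel_measurable M" and bd: "\<And>w. a \<le> \<phi> w" "\<And>w. \<phi> w \<le> c"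
    and h: "integrable M h" and N: "N \<in> sets M"
    and atomless: "\<And>t. emeasure M {w\<in>space M. w \<in> N \<and> \<phi> w = t} = 0"
    and s: "0 \<le> s" "s \<le> (\<integral>w. indicator N w * h w \<partial>M)"
  obtains t where "(\<integral>w. indicator {w \<in> N. \<phi> w \<le> t} w * h w \<partial>M) = s"
proof -
  have [measurable]: "h \<in> borel_measurable M" "N \<in> sets M" using h N by auto
  have Nsp: "w \<in> N \<Longrightarrow> w \<in> space M" for w using sets.sets_into_space[OF N] by auto
  have [measurable]: "{w \<in> N. \<phi> w \<le> t} \<in> sets M" for t
  proof -
    have "{w \<in> N. \<phi> w \<le> t} = {w \<in> space M. w \<in> N \<and> \<phi> w \<le> t}" using Nsp by auto
    then show ?thesis by simp
  qed
  define F where "F t = (\<integral>w. indicator {w \<in> N. \<phi> w \<le> t} w * h w \<partial>M)" for t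
  have "continuous (at t) F" for t
    unfolding continuous_at_sequentially comp_def
  proof (intro allI impI)
    fix T :: "nat \<Rightarrow> real" assume T: "T \<longlonglongrightarrow> t"
    show "(\<lambda>n. F (T n)) \<longlonglongrightarrow> F t"
      unfolding F_def
    proof (rule integral_dominated_convergence[where w = "\<lambda>w. \<bar>h w\<bar>"])
      have "AE w in M. \<not> (w \<in> N \<and> \<phi> w = t)"
        by (rule AE_I[OF _ atomless[of t]]) auto
      then show "AE w in M. (\<lambda>n. indicator {w \<in> N. \<phi> w \<le> T n} w * h w) \<longlonglongrightarrow>
          indicator {w \<in> N. \<phi> w \<le> t} w * h w"
      proof eventually_elim
        case (elim w)
        show ?case
        proof (cases "w \<in> N")
          case False then show ?thesis by simp
        next
          case True
          then consider "\<phi> w < t" | "t < \<phi> w" using elim by fastforce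
          then have "\<forall>\<^sub>F n in sequentially. (\<phi> w \<le> T n) = (\<phi> w \<le> t)"
          proof cases
            case 1 then show ?thesis using order_tendstoD(1)[OF T 1] by (auto elim: eventually_mono)
          next
            case 2 then show ?thesis using order_tendstoD(2)[OF T 2] by (auto elim: eventually_mono)
          qed
          then show ?thesis
            by (intro tendsto_eventually) (auto simp: indicator_def elim: eventually_mono)
        qed
      qed
    qed (use h in \<open>auto simp: indicator_def\<close>)
  qed
  moreover have "F (a - 1) = 0"
  proof -
    have "{w \<in> N. \<phi> w \<le> a - 1} = {}" using bd(1)[THEN order.trans, of _ "a - 1"] by auto
    then show ?thesis by (simp add: F_def)
  qed
  moreover have "F c = (\<integral>w. indicator N w * h w \<partial>M)"
    using bd(2) by (simp add: F_def)
  moreover have "a - 1 \<le> c" using bd(1)[of undefined] bd(2)[of undefined] by linarith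
  ultimately obtain t where "F t = s"
    using IVT[of F "a - 1" s c] s by auto
  then show ?thesis using that by (simp add: F_def)
qed

section \<open>The optimization problem\<close>

locale utility_problem = prob_space M for M :: "'a measure" +
  fixes Z :: "'a \<Rightarrow> real" and U :: "real \<Rightarrow> real" and x0 :: real
  assumes Z_meas [measurable]: "Z \<in> borel_measurable M"
    and Z_pos: "\<And>w. w \<in> space M \<Longrightarrow> 0 < Z w"
    and Z_int: "integrable M Z" and Z_mean: "(\<integral>w. Z w \<partial>M) = 1"
    and U: "utility U"
    and conj_finite: "\<And>y. 0 < y \<Longrightarrow> ext_expectation M (\<lambda>w. conj_fun U (y * Z w)) < \<infinity>"
    and x0: "0 < x0"
begin

text \<open>Real-valued for use in Bochner integrals. It is faithful at positive arguments; at 0,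
  where the conjugate may be \<infinity>, \<open>real_of_ereal\<close> would return 0, so finiteness
  has to be supplied separately.\<close>

definition v :: "real \<Rightarrow> real" where "v y = real_of_ereal (conj_fun U y)"

lemma v_measurable [measurable]: "v \<in> borel_measurable borel"
  unfolding v_def by measurable

lemma Uext_measurable [measurable]: "Uext U \<in> borel_measurable borel"
  by (rule borel_measurable_mono_ereal[OF mono_Uext[OF U]])

lemma Z_mult_nonneg: "w \<in> space M \<Longrightarrow> 0 \<le> r \<Longrightarrow> 0 \<le> Z w * r"
  using Z_pos[of w] by simp

lemma v_eq: "0 < y \<Longrightarrow> conj_fun U y = ereal (v y)"
  using conj_fun_real[OF U] by (simp add: v_def)

lemma v_ge: "0 < y \<Longrightarrow> 0 < x \<Longrightarrow> U x - x * y \<le> v y"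
  using conj_fun_ge[of x U y] by (simp add: v_eq)

lemma v_antimono: "0 < y \<Longrightarrow> y \<le> y' \<Longrightarrow> v y' \<le> v y"
  using conj_fun_antimono[of y y' U] by (simp add: v_eq)

text \<open>\<open>conj_finite\<close> also admits the value -\<infinity>, which
  \<open>ext_expectation\<close> assigns when the negative part is not integrable. Testing the
  supremum at x = 1 bounds the conjugate below by the integrable U 1 - y Z and excludes
  this.\<close>

lemma v_integrable:
  assumes y: "0 < y"
  shows "integrable M (\<lambda>w. v (y * Z w))"
proof -
  let ?k = "\<lambda>w. conj_fun U (y * Z w)"
  have k: "?k w = ereal (v (y * Z w))" if "w \<in> space M" for w
    using v_eq[of "y * Z w"] y Z_pos[OF that] by simp
  have pos: "(\<integral>\<^sup>+ w. e2ennreal (?k w) \<partial>M) = (\<integral>\<^sup>+ w. ennreal (v (y * Z w)) \<partial>M)"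
    by (intro nn_integral_cong) (simp add: k)
  have neg: "(\<integral>\<^sup>+ w. e2ennreal (- ?k w) \<partial>M) = (\<integral>\<^sup>+ w. ennreal (- v (y * Z w)) \<partial>M)"
    by (intro nn_integral_cong) (simp add: k)
  have "(\<integral>\<^sup>+ w. ennreal (- v (y * Z w)) \<partial>M) \<le> (\<integral>\<^sup>+ w. ennreal (norm (y * Z w - U 1)) \<partial>M)"
  proof (intro nn_integral_mono ennreal_leI)
    fix w assume "w \<in> space M"
    then show "- v (y * Z w) \<le> norm (y * Z w - U 1)"
      using v_ge[of "y * Z w" 1] y Z_pos by auto
  qed
  also have "\<dots> < \<infinity>"
    using integrableD(2)[of M "\<lambda>w. norm (y * Z w - U 1)"] Z_int by (auto simp: top.not_eq_extremum)
  finally have fin: "(\<integral>\<^sup>+ w. ennreal (- v (y * Z w)) \<partial>M) < \<infinity>" .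
  then have "ext_expectation M ?k = enn2ereal (\<integral>\<^sup>+ w. ennreal (v (y * Z w)) \<partial>M) -
      enn2ereal (\<integral>\<^sup>+ w. ennreal (- v (y * Z w)) \<partial>M)"
    unfolding ext_expectation_def pos neg by simp
  with conj_finite[OF y] fin have "(\<integral>\<^sup>+ w. ennreal (v (y * Z w)) \<partial>M) \<noteq> \<infinity>"
    by (cases "(\<integral>\<^sup>+ w. ennreal (- v (y * Z w)) \<partial>M)") auto
  with fin show ?thesis
    unfolding real_integrable_def by (auto simp: top.not_eq_extremum)
qed

lemma attainableD:
  assumes "f \<in> attainable M Z x0"
  shows "f \<in> borel_measurable M" "\<And>w. w \<in> space M \<Longrightarrow> 0 \<le> f w"
    "integrable M (\<lambda>w. Z w * f w)" "(\<integral>w. Z w * f w \<partial>M) \<le> x0"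
proof -
  show [measurable]: "f \<in> borel_measurable M" and nn: "\<And>w. w \<in> space M \<Longrightarrow> 0 \<le> f w"
    using assms by (auto simp: attainable_def)
  have nnZ: "AE w in M. 0 \<le> Z w * f w"
    using nn by (auto intro: Z_mult_nonneg)
  have le: "(\<integral>\<^sup>+ w. ennreal (Z w * f w) \<partial>M) \<le> ennreal x0"
    using assms by (auto simp: attainable_def)
  then show i: "integrable M (\<lambda>w. Z w * f w)"
    using nnZ by (intro integrableI_nonneg) (auto intro: le_less_trans)
  show "(\<integral>w. Z w * f w \<partial>M) \<le> x0"
    using le x0 nn_integral_eq_integral[OF i nnZ] by simp
qed

lemma attainableI:
  assumes "f \<in> borel_measurable M" "\<And>w. w \<in> space M \<Longrightarrow> 0 \<le> f w"
    "integrable M (\<lambda>w. Z w * f w)" "(\<integral>w. Z w * f w \<partial>M) \<le> x0"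
  shows "f \<in> attainable M Z x0"
proof -
  have nnZ: "AE w in M. 0 \<le> Z w * f w"
    using assms(2) by (auto intro: Z_mult_nonneg)
  have "(\<integral>\<^sup>+ w. ennreal (Z w * f w) \<partial>M) \<le> ennreal x0"
    unfolding nn_integral_eq_integral[OF assms(3) nnZ] by (rule ennreal_leI[OF assms(4)])
  then show ?thesis
    using assms(1,2) by (simp add: attainable_def)
qed

text \<open>Cost may escape in the limit on \<open>A\<close>; charging it only the multiplier \<open>y\<close> there makes the
  resulting error at most \<open>y * a\<close>, which vanishes as \<open>y\<close> tends to 0.\<close>

lemma limit_of_maximizing_sequence:
  assumes f: "\<And>n. f n \<in> attainable M Z x0"
    and lim_u: "(\<lambda>n. ext_expectation M (\<lambda>w. Uext U (f n w))) \<longlonglongrightarrow> ereal u"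
    and A [measurable]: "A \<in> sets M"
    and a: "(\<lambda>n. \<integral>w. indicator A w * (Z w * f n w) \<partial>M) \<longlonglongrightarrow> a"
    and b: "(\<lambda>n. \<integral>w. indicator (- A) w * (Z w * f n w) \<partial>M) \<longlonglongrightarrow> b"
    and g [measurable]: "g \<in> borel_measurable M" and g_nn: "\<And>w. w \<in> space M \<Longrightarrow> 0 \<le> g w"
    and conv: "AE w in M. w \<in> A \<longrightarrow> (\<lambda>n. f n w) \<longlonglongrightarrow> g w"
    and c: "0 \<le> c" "conj_fun U c < \<infinity>"
    and opt: "AE w in M. w \<notin> A \<longrightarrow> conj_opt U (c * Z w) (g w)"
    and g_int: "integrable M (\<lambda>w. indicator (- A) w * (Z w * g w))"
    and g_le: "(\<integral>w. indicator (- A) w * (Z w * g w) \<partial>M) \<le> b"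
    and slack: "c * (\<integral>w. indicator (- A) w * (Z w * g w) \<partial>M) = c * b"
  shows "g \<in> attainable M Z x0 \<and> ereal u \<le> ext_expectation M (\<lambda>w. Uext U (g w))"
proof -
  note fD = attainableD[OF f]
  have [measurable]: "f n \<in> borel_measurable M" for n by (rule fD)
  have nonneg: "0 \<le> Z w * f n w" "0 \<le> Z w * g w" if "w \<in> space M" for n w
    using fD(2)[OF that, of n] g_nn[OF that] by (auto intro: Z_mult_nonneg that)
  have f_intA: "integrable M (\<lambda>w. indicator A w * (Z w * f n w))"
    and f_intB: "integrable M (\<lambda>w. indicator (- A) w * (Z w * f n w))" for n
    by (rule Bochner_Integration.integrable_bound[OF fD(3)[of n]]; auto simp: indicator_def)+
  let ?an = "\<lambda>n. \<integral>w. indicator A w * (Z w * f n w) \<partial>M"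
  let ?bn = "\<lambda>n. \<integral>w. indicator (- A) w * (Z w * f n w) \<partial>M"
  let ?a' = "\<integral>w. indicator A w * (Z w * g w) \<partial>M"
  let ?b' = "\<integral>w. indicator (- A) w * (Z w * g w) \<partial>M"
  have split_ind: "z = indicator A w * z + indicator (- A) w * z" for w and z :: real
    by (auto simp: indicator_def)
  have ab: "a + b \<le> x0"
  proof (rule LIMSEQ_le_const2[OF tendsto_add[OF a b]], intro exI allI impI)
    fix n
    have "?an n + ?bn n = (\<integral>w. indicator A w * (Z w * f n w) + indicator (- A) w * (Z w * f n w) \<partial>M)"
      by (intro Bochner_Integration.integral_add[symmetric] f_intA f_intB)
    also have "\<dots> = (\<integral>w. Z w * f n w \<partial>M)" by (simp flip: split_ind)
    finally show "?an n + ?bn n \<le> x0" using fD(4)[of n] by simp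
  qed
  have a_nn: "0 \<le> a"
    by (rule LIMSEQ_le_const[OF a])
      (use nonneg in \<open>auto intro!: exI[of _ 0] Bochner_Integration.integral_nonneg\<close>)
  have g_intA: "integrable M (\<lambda>w. indicator A w * (Z w * g w))" and a': "?a' \<le> a"
  proof -
    have "AE w in M. (\<lambda>n. indicator A w * (Z w * f n w)) \<longlonglongrightarrow> indicator A w * (Z w * g w)"
      using conv
    proof eventually_elim
      case (elim w)
      then show ?case by (cases "w \<in> A") (auto intro!: tendsto_intros)
    qed
    moreover have "liminf (\<lambda>n. ennreal (?an n)) = ennreal a"
      using a by (intro lim_imp_Liminf tendsto_ennrealI) auto
    ultimately show "integrable M (\<lambda>w. indicator A w * (Z w * g w))" and "?a' \<le> a"
      using integral_fatou[of M "\<lambda>n w. indicator A w * (Z w * f n w)" "\<lambda>w. indicator A w * (Z w * g w)" a]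
        f_intA nonneg a_nn by (auto intro!: AE_I2)
  qed
  have a'_nn: "0 \<le> ?a'" using nonneg by (intro Bochner_Integration.integral_nonneg) auto
  have attain: "g \<in> attainable M Z x0"
  proof (rule attainableI)
    have eq: "Z w * g w = indicator A w * (Z w * g w) + indicator (- A) w * (Z w * g w)" for w
      by (rule split_ind)
    show "integrable M (\<lambda>w. Z w * g w)"
      by (subst eq) (intro Bochner_Integration.integrable_add g_intA g_int)
    have "(\<integral>w. Z w * g w \<partial>M) = ?a' + ?b'"
      by (subst eq) (intro Bochner_Integration.integral_add g_intA g_int)
    then show "(\<integral>w. Z w * g w \<partial>M) \<le> x0" using a' g_le ab by simp
  qed (use g_nn in auto)
  have approx: "ereal u \<le> ext_expectation M (\<lambda>w. Uext U (g w)) + ereal (y * a)" if y: "0 < y" for y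
  proof -
    define E where "E w = (if w \<in> A then y else c)" for w
    have [measurable]: "E \<in> borel_measurable M" unfolding E_def by measurable
    have cZ: "conj_fun U (E w * Z w) = ereal (v (E w * Z w))" if "w \<in> space M" for w
    proof (cases "0 < E w")
      case True then show ?thesis using Z_pos[OF that] by (intro v_eq) simp
    next
      case False
      \<comment> \<open>Only c = 0 off \<open>A\<close> leads here; the argument is then
        \<open>c\<close> itself, whose conjugate is finite by assumption.\<close>
      then have "E w * Z w = c" using c y by (auto simp: E_def split: if_splits)
      then show ?thesis using c conj_fun_gt_bot[of U c] by (cases "conj_fun U c") (auto simp: v_def)
    qed
    have E_nn: "0 \<le> E w" for w using y c by (simp add: E_def)
    define k where "k w = v (E w * Z w)" for w
    have k_int: "integrable M k"
    proof -
      have i: "integrable M (\<lambda>w. v (c * Z w))"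
        using v_integrable[of c] c by (cases "c = 0") auto
      have "integrable M (\<lambda>w. if w \<in> A then v (y * Z w) else v (c * Z w))"
        by (rule integrable_piecewise[OF v_integrable[OF y] i A])
      moreover have "k = (\<lambda>w. if w \<in> A then v (y * Z w) else v (c * Z w))"
        by (auto simp: k_def E_def)
      ultimately show ?thesis by simp
    qed
    \<comment> \<open>The Lagrangian identity: expected utility is the dual value plus the priced
      costs on both parts minus the integrated Fenchel gap. It remains valid when the expectation is
      -\<infinity>.\<close>
    have exp_eq: "ext_expectation M (\<lambda>w. Uext U (r w)) =
        ereal ((\<integral>w. k w \<partial>M) + y * (\<integral>w. indicator A w * (Z w * r w) \<partial>M) +
          c * (\<integral>w. indicator (- A) w * (Z w * r w) \<partial>M)) -
        enn2ereal (\<integral>\<^sup>+ w. e2ennreal (ereal (k w + E w * (Z w * r w)) - Uext U (r w)) \<partial>M)"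
      if [measurable]: "r \<in> borel_measurable M" and r_nn: "\<And>w. w \<in> space M \<Longrightarrow> 0 \<le> r w"
        and i: "integrable M (\<lambda>w. indicator A w * (Z w * r w))"
          "integrable M (\<lambda>w. indicator (- A) w * (Z w * r w))" for r
    proof -
      have eq: "k w + E w * (Z w * r w) =
          k w + y * (indicator A w * (Z w * r w)) + c * (indicator (- A) w * (Z w * r w))" for w
        by (simp add: E_def)
      have "integrable M (\<lambda>w. k w + E w * (Z w * r w))"
        unfolding eq using k_int i by simp
      moreover have "Uext U (r w) \<le> ereal (k w + E w * (Z w * r w))" if "w \<in> space M" for w
        using Uext_le_conj[OF U r_nn[OF that], of "E w * Z w"] cZ[OF that] E_nn[of w] Z_pos[OF that]
        by (simp add: k_def mult_ac)
      ultimately have "ext_expectation M (\<lambda>w. Uext U (r w)) =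
          ereal (\<integral>w. k w + E w * (Z w * r w) \<partial>M) -
          enn2ereal (\<integral>\<^sup>+ w. e2ennreal (ereal (k w + E w * (Z w * r w)) - Uext U (r w)) \<partial>M)"
        by (intro ext_expectation_eq) simp_all
      moreover have "(\<integral>w. k w + E w * (Z w * r w) \<partial>M) = (\<integral>w. k w \<partial>M) +
          y * (\<integral>w. indicator A w * (Z w * r w) \<partial>M) + c * (\<integral>w. indicator (- A) w * (Z w * r w) \<partial>M)"
        unfolding eq using k_int i by simp
      ultimately show ?thesis by simp
    qed
    let ?loss = "\<lambda>r w. e2ennreal (ereal (k w + E w * (Z w * r w)) - Uext U (r w))"
    define s where "s n = (\<integral>w. k w \<partial>M) + y * ?an n + c * ?bn n" for n
    define S where "S = (\<integral>w. k w \<partial>M) + y * a + c * b"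
    have s: "s \<longlonglongrightarrow> S" unfolding s_def S_def by (intro tendsto_intros a b)
    have [measurable]: "k \<in> borel_measurable M" using k_int by simp
    have loss_n: "(\<integral>\<^sup>+ w. ?loss (f n) w \<partial>M) =
        e2ennreal (ereal (s n) - ext_expectation M (\<lambda>w. Uext U (f n w)))" for n
    proof -
      let ?L = "\<integral>\<^sup>+ w. ?loss (f n) w \<partial>M"
      have "ext_expectation M (\<lambda>w. Uext U (f n w)) = ereal (s n) - enn2ereal ?L"
        unfolding s_def by (intro exp_eq fD f_intA f_intB)
      then have "ereal (s n) - ext_expectation M (\<lambda>w. Uext U (f n w)) = enn2ereal ?L"
        by (cases "enn2ereal ?L") auto
      then show ?thesis by simp
    qed
    have "(\<integral>\<^sup>+ w. ?loss g w \<partial>M) \<le> (\<integral>\<^sup>+ w. liminf (\<lambda>n. ?loss (f n) w) \<partial>M)"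
    proof (rule nn_integral_mono_AE)
      \<comment> \<open>Off \<open>A\<close> the loss of \<open>g\<close> is zero by optimality,
        whatever \<open>f n\<close> does there; on \<open>A\<close> upper semicontinuity of
        \<open>Uext\<close> gives the inequality.\<close>
      show "AE w in M. ?loss g w \<le> liminf (\<lambda>n. ?loss (f n) w)"
        using conv opt AE_space
      proof eventually_elim
        case (elim w)
        show ?case
        proof (cases "w \<in> A")
          case False
          then have o: "conj_opt U (E w * Z w) (g w)" using elim by (simp add: E_def)
          then have "ereal (k w + E w * (Z w * g w)) - Uext U (g w) = 0"
            using cZ[OF elim(3)]
            by (cases "Uext U (g w)") (auto simp: conj_opt_def k_def mult_ac)
          then show ?thesis by (simp add: e2ennreal_neg)
        next
          case True
          have X: "(\<lambda>n. f n w) \<longlonglongrightarrow> g w" using True elim by simp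
          have "(\<lambda>n. ereal (k w + E w * (Z w * f n w))) \<longlonglongrightarrow> ereal (k w + E w * (Z w * g w))"
            by (intro tendsto_intros X)
          then have "liminf (\<lambda>n. ereal (k w + E w * (Z w * f n w)) + - Uext U (f n w)) =
              ereal (k w + E w * (Z w * g w)) + liminf (\<lambda>n. - Uext U (f n w))"
            by (rule ereal_liminf_lim_add) simp
          also have "\<dots> = ereal (k w + E w * (Z w * g w)) - limsup (\<lambda>n. Uext U (f n w))"
            by (simp add: ereal_Liminf_uminus minus_ereal_def)
          also have "\<dots> \<ge> ereal (k w + E w * (Z w * g w)) - Uext U (g w)"
            using Uext_limsup[OF U X] elim g_nn by (intro ereal_minus_mono) auto
          finally have "?loss g w \<le>
              e2ennreal (liminf (\<lambda>n. ereal (k w + E w * (Z w * f n w)) - Uext U (f n w)))"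
            by (intro e2ennreal_mono) (simp add: minus_ereal_def)
          also have "\<dots> = liminf (\<lambda>n. ?loss (f n) w)"
            by (rule Liminf_compose_continuous_mono[symmetric])
              (auto intro: continuous_on_e2ennreal monoI e2ennreal_mono)
          finally show ?thesis .
        qed
      qed
    qed
    also have "\<dots> \<le> liminf (\<lambda>n. \<integral>\<^sup>+ w. ?loss (f n) w \<partial>M)"
      by (intro nn_integral_liminf) simp
    also have "\<dots> = e2ennreal (ereal S - ereal u)"
      unfolding loss_n using s lim_u
      by (intro lim_imp_Liminf tendsto_e2ennrealI tendsto_diff_ereal) auto
    finally have L: "(\<integral>\<^sup>+ w. ?loss g w \<partial>M) \<le> ennreal (S - u)" by simp
    \<comment> \<open>\<open>ennreal\<close> truncates negative numbers to 0, so \<open>L\<close>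
      bounds the loss by S - u only once this sign is known.\<close>
    have "0 \<le> ereal S - ereal u"
    proof (rule tendsto_lowerbound)
      show "((\<lambda>n. ereal (s n) - ext_expectation M (\<lambda>w. Uext U (f n w))) \<longlongrightarrow> ereal S - ereal u) sequentially"
        using s lim_u by (intro tendsto_diff_ereal) auto
      show "\<forall>\<^sub>F n in sequentially. 0 \<le> ereal (s n) - ext_expectation M (\<lambda>w. Uext U (f n w))"
      proof (rule always_eventually, rule allI)
        fix n
        have "ext_expectation M (\<lambda>w. Uext U (f n w)) = ereal (s n) - enn2ereal (\<integral>\<^sup>+ w. ?loss (f n) w \<partial>M)"
          unfolding s_def by (intro exp_eq fD f_intA f_intB)
        then show "0 \<le> ereal (s n) - ext_expectation M (\<lambda>w. Uext U (f n w))"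
          by (cases "enn2ereal (\<integral>\<^sup>+ w. ?loss (f n) w \<partial>M)";
              use enn2ereal_nonneg[of "\<integral>\<^sup>+ w. ?loss (f n) w \<partial>M"] in auto)
      qed
    qed simp
    then have "0 \<le> S - u" by simp
    then have L': "enn2ereal (\<integral>\<^sup>+ w. ?loss g w \<partial>M) \<le> ereal (S - u)"
      using L by (metis enn2ereal_ennreal less_eq_ennreal.rep_eq)
    have exp_g: "ext_expectation M (\<lambda>w. Uext U (g w)) =
        ereal ((\<integral>w. k w \<partial>M) + y * ?a' + c * ?b') - enn2ereal (\<integral>\<^sup>+ w. ?loss g w \<partial>M)"
      by (intro exp_eq g g_nn g_intA g_int)
    have "ereal ((\<integral>w. k w \<partial>M) + y * ?a' + c * ?b') - ereal (S - u) \<le>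
        ext_expectation M (\<lambda>w. Uext U (g w))"
      unfolding exp_g by (intro ereal_minus_mono order.refl L')
    \<comment> \<open>By \<open>slack\<close> the terms with \<open>c\<close> cancel; what is left
      is the cost lost on \<open>A\<close>, priced at y.\<close>
    moreover have "(\<integral>w. k w \<partial>M) + y * ?a' + c * ?b' - (S - u) = u + y * ?a' - y * a"
      using slack unfolding S_def by linarith
    ultimately have "ereal (u + y * ?a' - y * a) \<le> ext_expectation M (\<lambda>w. Uext U (g w))"
      by simp
    moreover have "ereal (u - y * a) \<le> ereal (u + y * ?a' - y * a)" using y a'_nn by simp
    ultimately have "ereal (u - y * a) + ereal (y * a) \<le>
        ext_expectation M (\<lambda>w. Uext U (g w)) + ereal (y * a)"
      by (intro add_right_mono) (rule order.trans)
    then show ?thesis by simp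
  qed
  have "ereal u \<le> ext_expectation M (\<lambda>w. Uext U (g w))"
  proof (rule ereal_le_epsilon2)
    fix e :: real assume e: "0 < e"
    have "ereal u \<le> ext_expectation M (\<lambda>w. Uext U (g w)) + ereal (e / (a + 1) * a)"
      using e a_nn by (intro approx) simp
    also have "\<dots> \<le> ext_expectation M (\<lambda>w. Uext U (g w)) + ereal e"
      using e a_nn by (intro add_left_mono) (simp add: field_simps)
    finally show "ereal u \<le> ext_expectation M (\<lambda>w. Uext U (g w)) + ereal e" .
  qed
  with attain show ?thesis by simp
qed

section \<open>Pointwise maximizers and spending a prescribed budget\<close>

definition I :: "real \<Rightarrow> real" where "I y = (if 0 < y then SOME x. conj_opt U y x else 0)"

lemma I_opt: "0 < y \<Longrightarrow> conj_opt U y (I y)"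
  unfolding I_def using someI_ex[OF conj_opt_exists[OF U]] by simp

lemma I_nonneg: "0 \<le> I y"
  using I_opt[of y] by (cases "0 < y") (auto simp: conj_opt_def I_def)

lemma I_antimono: "0 < y \<Longrightarrow> y \<le> y' \<Longrightarrow> I y' \<le> I y"
  using conj_opt_antimono[OF U _ _ I_opt I_opt, of y y'] by (cases "y = y'") auto

text \<open>Monotonicity replaces a measurable selection theorem: whichever maximizers
  \<open>SOME\<close> picks, \<open>conj_opt_antimono\<close> orders them, and the default 0 is
  constant on the other half-line. \<open>I\<close> generalizes the inverse of marginal
  utility.\<close>

lemma I_measurable [measurable]: "I \<in> borel_measurable borel"
proof -
  have "(\<lambda>y. - I y) \<in> borel_measurable borel"
  proof (rule borel_measurable_piecewise_mono[of "{{..0}, {0<..}}"])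
    show "mono_on c (\<lambda>y. - I y)" if "c \<in> {{..0}, {0<..}}" for c
      using that I_antimono by (auto simp: mono_on_def I_def)
  qed auto
  then show ?thesis by simp
qed

lemma cost_I_bound:
  assumes y: "0 < y" and w: "w \<in> space M"
  shows "Z w * I (y * Z w) \<le> 2 / y * (v (y / 2 * Z w) - v (y * Z w))"
  using conj_opt_bound[OF U _ I_opt, of "y * Z w"] y Z_pos[OF w]
  by (simp add: v_def field_simps)

lemma cost_I_integrable:
  assumes y: "0 < y"
  shows "integrable M (\<lambda>w. Z w * I (y * Z w))"
proof (rule Bochner_Integration.integrable_bound)
  show "integrable M (\<lambda>w. 2 / y * (v (y / 2 * Z w) - v (y * Z w)))"
    using v_integrable[of "y / 2"] v_integrable[of y] y
    by (intro integrable_mult_right Bochner_Integration.integrable_diff) auto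
  show "AE w in M. norm (Z w * I (y * Z w)) \<le> norm (2 / y * (v (y / 2 * Z w) - v (y * Z w)))"
  proof (rule AE_I2)
    fix w assume w: "w \<in> space M"
    show "norm (Z w * I (y * Z w)) \<le> norm (2 / y * (v (y / 2 * Z w) - v (y * Z w)))"
      using cost_I_bound[OF y w] Z_mult_nonneg[OF w I_nonneg, of "y * Z w"]
      unfolding real_norm_def by linarith
  qed
qed simp

text \<open>In \<open>cost_I_bound\<close> the first conjugate stays below V(Z) once Y \<ge> 2, and
  the second is bounded below by testing at one small point d. The term d Y Z grows with Y, but the
  factor 2/Y reduces it to 2 d in the mean.\<close>

lemma cost_I_vanishes:
  assumes e: "0 < e"
  obtains Y where "0 < Y" "(\<integral>w. Z w * I (Y * Z w) \<partial>M) < e"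
proof
  \<comment> \<open>The final bound is 2 K / Y + 2 d: this d makes the second term e/2, and Y is
    chosen to make the first smaller than e/2.\<close>
  define d where "d = e / 4"
  define K where "K = (\<integral>w. v (1 * Z w) \<partial>M) - U d"
  define Y where "Y = 2 + 4 * \<bar>K\<bar> / e"
  have d: "0 < d" and Y: "2 \<le> Y" using e by (auto simp: d_def Y_def)
  then show "0 < Y" by simp
  note i = v_integrable[of "Y / 2"] v_integrable[of Y] v_integrable[of 1]
  have "(\<integral>w. Z w * I (Y * Z w) \<partial>M) \<le> (\<integral>w. 2 / Y * (v (1 * Z w) - (U d - d * Y * Z w)) \<partial>M)"
  proof (rule integral_mono)
    fix w assume w: "w \<in> space M"
    have "Z w * I (Y * Z w) \<le> 2 / Y * (v (Y / 2 * Z w) - v (Y * Z w))"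
      using Y by (intro cost_I_bound w) simp
    also have "\<dots> \<le> 2 / Y * (v (1 * Z w) - (U d - d * Y * Z w))"
    proof (intro mult_left_mono diff_mono)
      show "v (Y / 2 * Z w) \<le> v (1 * Z w)"
        using Y Z_pos[OF w] by (intro v_antimono mult_right_mono) auto
      show "U d - d * Y * Z w \<le> v (Y * Z w)"
        using v_ge[of "Y * Z w" d] Y Z_pos[OF w] d by (simp add: mult.assoc)
    qed (use Y in simp)
    finally show "Z w * I (Y * Z w) \<le> 2 / Y * (v (1 * Z w) - (U d - d * Y * Z w))" .
  qed (use Y i Z_int in \<open>auto intro!: cost_I_integrable\<close>)
  also have "\<dots> = 2 / Y * ((\<integral>w. v (1 * Z w) \<partial>M) - (U d - d * Y))"
    using i Z_int Z_mean prob_space by simp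
  also have "\<dots> = 2 * K / Y + e / 2"
    using Y by (simp add: K_def d_def field_simps)
  also have "\<dots> < e"
  proof -
    have "4 * \<bar>K\<bar> / e < Y" by (simp add: Y_def)
    then have "4 * \<bar>K\<bar> < Y * e" using e by (simp add: field_simps)
    then have "4 * K < Y * e" by linarith
    then show ?thesis using Y e by (simp add: field_simps)
  qed
  finally show "(\<integral>w. Z w * I (Y * Z w) \<partial>M) < e" .
qed

text \<open>The critical multiplier \<open>c\<close> is 0 precisely when no positive multiplier exhausts the budget
  \<open>b\<close>; the increasing limit \<open>gl\<close> of maximizers is then a point where \<open>U\<close> is saturated.\<close>

lemma optimal_allocation:
  fixes \<phi> :: "'a \<Rightarrow> real"
  assumes A [measurable]: "A \<in> sets M"
    and phi [measurable]: "\<phi> \<in> borel_measurable M" and bd: "\<And>w. lo \<le> \<phi> w" "\<And>w. \<phi> w \<le> hi"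
    and atomless: "\<And>t. emeasure M {w\<in>space M. w \<in> space M - A \<and> \<phi> w = t} = 0"
    and pos: "\<not> (AE w in M. w \<in> A)" and b: "0 < b"
  obtains g c where "g \<in> borel_measurable M" "\<And>w. 0 \<le> g w" "0 \<le> c" "conj_fun U c < \<infinity>"
    "AE w in M. w \<notin> A \<longrightarrow> conj_opt U (c * Z w) (g w)"
    "integrable M (\<lambda>w. indicator (- A) w * (Z w * g w))"
    "(\<integral>w. indicator (- A) w * (Z w * g w) \<partial>M) \<le> b"
    "c * (\<integral>w. indicator (- A) w * (Z w * g w) \<partial>M) = c * b"
proof -
  define X where "X y w = indicator (- A) w * (Z w * I (y * Z w))" for y w
  define G where "G y = (\<integral>w. X y w \<partial>M)" for y
  have [measurable]: "X y \<in> borel_measurable M" for y unfolding X_def by measurable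
  have X_int: "integrable M (X y)" if "0 < y" for y
    by (rule Bochner_Integration.integrable_bound[OF cost_I_integrable[OF that]])
      (auto simp: X_def indicator_def)
  have X_nn: "0 \<le> X y w" if "w \<in> space M" for y w
    using Z_mult_nonneg[OF that I_nonneg] by (simp add: X_def)
  have X_mono: "X y' w \<le> X y w" if "w \<in> space M" "0 < y" "y \<le> y'" for y y' w
    unfolding X_def using that Z_pos[OF that(1)]
    by (intro mult_left_mono I_antimono) auto
  have G_mono: "G y' \<le> G y" if "0 < y" "y \<le> y'" for y y'
    unfolding G_def using that by (intro integral_mono X_int X_mono) auto
  obtain Y where Y: "0 < Y" "(\<integral>w. Z w * I (Y * Z w) \<partial>M) < b"
    using cost_I_vanishes[OF b] .
  have "G Y \<le> (\<integral>w. Z w * I (Y * Z w) \<partial>M)"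
    unfolding G_def using Y(1) Z_mult_nonneg I_nonneg
    by (intro integral_mono X_int cost_I_integrable) (auto simp: X_def indicator_def)
  then have GY: "G Y < b" using Y by simp
  \<comment> \<open>Since \<open>G\<close> decreases, this is an initial segment of the positive
    half-line; it is bounded by \<open>Y\<close>, and its supremum is the critical
    multiplier.\<close>
  define S where "S = {y. 0 < y \<and> b \<le> G y}"
  have S_le: "y \<le> Y" if "y \<in> S" for y
  proof (rule ccontr)
    assume "\<not> y \<le> Y"
    then have "G y \<le> G Y" using Y(1) by (intro G_mono) auto
    then show False using that GY by (simp add: S_def)
  qed
  then have bdd: "bdd_above S" by (auto simp: bdd_above_def)
  define c where "c = (if S = {} then 0 else Sup S)"
  have S_le_c: "y \<le> c" if "y \<in> S" for y
    using that cSup_upper[OF that bdd] by (auto simp: c_def)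
  have c: "0 \<le> c"
  proof (cases "S = {}")
    case False
    then obtain y where "y \<in> S" by auto
    then show ?thesis using S_le_c[of y] by (auto simp: S_def)
  qed (simp add: c_def)
  have above: "G y < b" if "c < y" for y
  proof (rule ccontr)
    assume "\<not> G y < b"
    then have "y \<in> S" using that c by (simp add: S_def)
    with S_le_c[of y] that show False by simp
  qed
  have below: "b \<le> G y" if "0 < y" "y < c" for y
  proof -
    have "S \<noteq> {}" using that by (auto simp: c_def)
    then have "y < Sup S" using that by (simp add: c_def)
    then obtain z where "z \<in> S" "y < z"
      using \<open>S \<noteq> {}\<close> less_cSup_iff[OF _ bdd] by auto
    then show ?thesis using G_mono[of y z] that by (auto simp: S_def)
  qed
  have limit_opt: "conj_opt U (c * Z w) x"
    if w: "w \<in> space M" and y: "\<And>n. 0 < y n" "y \<longlonglongrightarrow> c" and x: "(\<lambda>n. I (y n * Z w)) \<longlonglongrightarrow> x"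
    for w x and y :: "nat \<Rightarrow> real"
  proof (rule conj_opt_limit[OF U])
    show "(\<lambda>n. y n * Z w) \<longlonglongrightarrow> c * Z w" by (intro tendsto_intros y)
    then show "conj_fun U (c * Z w) \<le> liminf (\<lambda>n. conj_fun U (y n * Z w))"
      by (rule conj_fun_liminf)
    show "0 \<le> c * Z w" using c Z_pos[OF w] by simp
    show "0 \<le> x" using x I_nonneg by (auto intro: LIMSEQ_le_const)
    show "conj_fun U (y n * Z w) \<le> Uext U (I (y n * Z w)) + ereal (- (I (y n * Z w) * (y n * Z w)))" for n
      using I_opt[of "y n * Z w"] y(1)[of n] Z_pos[OF w] by (simp add: conj_opt_def)
  qed (rule x)

  define yl where "yl n = c + inverse (real (Suc n))" for n
  have yl: "c < yl n" "yl \<longlonglongrightarrow> c" "yl (Suc n) \<le> yl n" for n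
  proof -
    show "yl \<longlonglongrightarrow> c"
      unfolding yl_def using tendsto_add[OF tendsto_const LIMSEQ_inverse_real_of_nat, of c] by simp
  qed (auto simp: yl_def field_simps)
  have yl_pos: "0 < yl n" for n using yl(1)[of n] c by simp
  \<comment> \<open>\<open>lim\<close> is arbitrary where the sequence diverges;
    \<open>max 0\<close> secures nonnegativity there and leaves genuine limits unchanged.\<close>
  define gl where "gl w = max 0 (lim (\<lambda>n. I (yl n * Z w)))" for w
  have [measurable]: "gl \<in> borel_measurable M" unfolding gl_def by measurable
  have gl_nn: "0 \<le> gl w" for w by (simp add: gl_def)
  \<comment> \<open>As the multipliers decrease the maximizers increase, and for c = 0 they might
    explode; the common bound \<open>b\<close> on their costs prevents this almost everywhere off
    \<open>A\<close>.\<close>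
  have "AE w in M. convergent (\<lambda>n. X (yl n) w)"
    using above yl by (intro AE_convergent_of_bounded_integrals[where b = b] X_int yl_pos X_nn X_mono)
      (auto simp: G_def[symmetric] less_imp_le)
  then have gl_lim: "AE w in M. w \<notin> A \<longrightarrow> (\<lambda>n. I (yl n * Z w)) \<longlonglongrightarrow> gl w"
    using AE_space
  proof eventually_elim
    case (elim w)
    show ?case
    proof
      assume "w \<notin> A"
      then have "convergent (\<lambda>n. Z w * I (yl n * Z w))" using elim by (simp add: X_def)
      then have "convergent (\<lambda>n. I (yl n * Z w))"
        using Z_pos[OF elim(2)] by (simp add: convergent_mult_const_iff)
      then have l: "(\<lambda>n. I (yl n * Z w)) \<longlonglongrightarrow> lim (\<lambda>n. I (yl n * Z w))"
        by (simp add: convergent_LIMSEQ_iff)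
      then have "0 \<le> lim (\<lambda>n. I (yl n * Z w))" using I_nonneg by (auto intro: LIMSEQ_le_const)
      then show "(\<lambda>n. I (yl n * Z w)) \<longlonglongrightarrow> gl w" using l by (simp add: gl_def)
    qed
  qed
  have gl_opt: "AE w in M. w \<notin> A \<longrightarrow> conj_opt U (c * Z w) (gl w)"
    using gl_lim AE_space by eventually_elim (auto intro: limit_opt yl yl_pos)
  have "AE w in M. (\<lambda>n. X (yl n) w) \<longlonglongrightarrow> indicator (- A) w * (Z w * gl w)"
    using gl_lim
  proof eventually_elim
    case (elim w)
    then show ?case unfolding X_def by (cases "w \<in> A") (auto intro!: tendsto_intros)
  qed
  moreover have "liminf (\<lambda>n. ennreal (\<integral>w. X (yl n) w \<partial>M)) \<le> ennreal b"
  proof -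
    have "limsup (\<lambda>n. ennreal (\<integral>w. X (yl n) w \<partial>M)) \<le> ennreal b"
      using above[OF yl(1)] by (intro Limsup_bounded always_eventually allI ennreal_leI) (simp add: G_def less_imp_le)
    then show ?thesis using Liminf_le_Limsup[of sequentially] by (metis order.trans sequentially_bot)
  qed
  ultimately have gl_int: "integrable M (\<lambda>w. indicator (- A) w * (Z w * gl w))"
    and gl_le: "(\<integral>w. indicator (- A) w * (Z w * gl w) \<partial>M) \<le> b"
    using integral_fatou[of M "\<lambda>n. X (yl n)" "\<lambda>w. indicator (- A) w * (Z w * gl w)" b]
      X_int yl_pos X_nn b by auto
  show ?thesis
  proof (cases "c = 0")
    case True
    \<comment> \<open>Since the complement of \<open>A\<close> is not null, some point carries a
      maximizer at slope 0, and one such point already makes the conjugate at 0 finite.\<close>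
    have "\<not> (AE w in M. \<not> (w \<notin> A \<and> conj_opt U 0 (gl w)))"
    proof
      assume "AE w in M. \<not> (w \<notin> A \<and> conj_opt U 0 (gl w))"
      then have "AE w in M. w \<in> A"
        using gl_opt by eventually_elim (auto simp: True)
      with pos show False ..
    qed
    then obtain w where "conj_opt U 0 (gl w)" by (auto intro: AE_I2)
    then have "conj_fun U 0 < \<infinity>"
      using Uext_less_top[OF U, of "gl w"] by (auto simp: conj_opt_def)
    then show ?thesis
      using that[of gl 0] gl_nn gl_opt gl_int gl_le True by simp
  next
    case False
    then have c_pos: "0 < c" using c by simp
    \<comment> \<open>The shift by two makes the first term c/2 > 0, so that X (yu 0) dominates the
      sequence. Costs therefore converge, and their lower bound \<open>b\<close> passes to the
      limit.\<close>
    define yu where "yu n = c - c / real (Suc (Suc n))" for n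
    have yu: "0 < yu n" "yu n < c" "yu n \<le> yu (Suc n)" "yu 0 \<le> yu n" "yu \<longlonglongrightarrow> c" for n
    proof -
      have "(\<lambda>n. c / real (Suc n)) \<longlonglongrightarrow> 0"
        by (rule LIMSEQ_Suc[OF lim_const_over_n])
      from LIMSEQ_Suc[OF this] have "(\<lambda>n. c - c / real (Suc (Suc n))) \<longlonglongrightarrow> c - 0"
        by (intro tendsto_intros)
      then show "yu \<longlonglongrightarrow> c" by (simp add: yu_def[abs_def])
    qed (use c_pos in \<open>auto simp: yu_def field_simps add_pos_nonneg\<close>)
    define gu where "gu w = max 0 (lim (\<lambda>n. I (yu n * Z w)))" for w
    have [measurable]: "gu \<in> borel_measurable M" unfolding gu_def by measurable
    have gu_lim: "(\<lambda>n. I (yu n * Z w)) \<longlonglongrightarrow> gu w" if w: "w \<in> space M" for w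
    proof -
      have "decseq (\<lambda>n. I (yu n * Z w))"
        using yu Z_pos[OF w] by (intro decseq_SucI I_antimono) auto
      then obtain l where l: "(\<lambda>n. I (yu n * Z w)) \<longlonglongrightarrow> l"
        using decseq_convergent[of "\<lambda>n. I (yu n * Z w)" 0] I_nonneg by metis
      moreover have "0 \<le> l" using l I_nonneg by (auto intro: LIMSEQ_le_const)
      ultimately show ?thesis by (simp add: gu_def limI)
    qed
    have gu_opt: "conj_opt U (c * Z w) (gu w)" if "w \<in> space M" for w
      by (rule limit_opt[OF that yu(1) yu(5) gu_lim[OF that]])
    have X_lim: "(\<lambda>n. X (yu n) w) \<longlonglongrightarrow> indicator (- A) w * (Z w * gu w)" if "w \<in> space M" for w
      unfolding X_def by (intro tendsto_intros gu_lim that)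
    have X_dom: "AE w in M. norm (X (yu n) w) \<le> X (yu 0) w" for n
      using X_nn X_mono yu by (intro AE_I2) auto
    have gu_int: "integrable M (\<lambda>w. indicator (- A) w * (Z w * gu w))"
      by (rule integrable_dominated_convergence[where s = "\<lambda>n. X (yu n)" and w = "X (yu 0)"])
        (use X_int[OF yu(1)] X_dom X_lim in auto)
    have "(\<lambda>n. G (yu n)) \<longlonglongrightarrow> (\<integral>w. indicator (- A) w * (Z w * gu w) \<partial>M)"
      unfolding G_def
      by (rule integral_dominated_convergence[where s = "\<lambda>n. X (yu n)" and w = "X (yu 0)"])
        (use X_int[OF yu(1)] X_dom X_lim in auto)
    then have gu_ge: "b \<le> (\<integral>w. indicator (- A) w * (Z w * gu w) \<partial>M)"
      using below yu by (intro LIMSEQ_le_const) auto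
    \<comment> \<open>The extra cost of switching from \<open>gl\<close> to \<open>gu\<close>;
      integrated over the complement of \<open>A\<close> it covers the gap between the cost of
      \<open>gl\<close> and \<open>b\<close>.\<close>
    define h where "h w = indicator (- A) w * (Z w * gu w) - indicator (- A) w * (Z w * gl w)" for w
    have h_int: "integrable M h" unfolding h_def by (intro Bochner_Integration.integrable_diff gu_int gl_int)
    have h_eq: "(\<integral>w. indicator (space M - A) w * h w \<partial>M) =
        (\<integral>w. indicator (- A) w * (Z w * gu w) \<partial>M) - (\<integral>w. indicator (- A) w * (Z w * gl w) \<partial>M)"
    proof -
      have "(\<integral>w. indicator (space M - A) w * h w \<partial>M) = (\<integral>w. h w \<partial>M)"
        by (intro Bochner_Integration.integral_cong) (auto simp: h_def indicator_def)
      also have "\<dots> = (\<integral>w. indicator (- A) w * (Z w * gu w) \<partial>M) - (\<integral>w. indicator (- A) w * (Z w * gl w) \<partial>M)"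
        unfolding h_def by (intro Bochner_Integration.integral_diff gu_int gl_int)
      finally show ?thesis .
    qed
    obtain t where t: "(\<integral>w. indicator {w \<in> space M - A. \<phi> w \<le> t} w * h w \<partial>M) =
        b - (\<integral>w. indicator (- A) w * (Z w * gl w) \<partial>M)"
    proof (rule integral_slice_intermediate[OF phi bd h_int sets.compl_sets[OF A] atomless])
      show "0 \<le> b - (\<integral>w. indicator (- A) w * (Z w * gl w) \<partial>M)" using gl_le by simp
      show "b - (\<integral>w. indicator (- A) w * (Z w * gl w) \<partial>M) \<le>
          (\<integral>w. indicator (space M - A) w * h w \<partial>M)"
        using gu_ge unfolding h_eq by simp
    qed
    define g where "g w = (if \<phi> w \<le> t then gu w else gl w)" for w
    have g_eq: "indicator (- A) w * (Z w * g w) = indicator (- A) w * (Z w * gl w) +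
        indicator {w \<in> space M - A. \<phi> w \<le> t} w * h w" if "w \<in> space M" for w
      using that by (auto simp: g_def h_def indicator_def)
    have [measurable]: "{w \<in> space M - A. \<phi> w \<le> t} \<in> sets M"
    proof -
      have "{w \<in> space M - A. \<phi> w \<le> t} = {w \<in> space M. w \<notin> A \<and> \<phi> w \<le> t}" by auto
      then show ?thesis by simp
    qed
    have s_int: "integrable M (\<lambda>w. indicator {w \<in> space M - A. \<phi> w \<le> t} w * h w)"
      using h_int by (intro Bochner_Integration.integrable_bound[OF h_int]) (auto simp: indicator_def)
    have g_int: "integrable M (\<lambda>w. indicator (- A) w * (Z w * g w))"
      using Bochner_Integration.integrable_add[OF gl_int s_int]
      by (subst Bochner_Integration.integrable_cong[OF refl g_eq])
    have g_b: "(\<integral>w. indicator (- A) w * (Z w * g w) \<partial>M) = b"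
      using t by (simp only: Bochner_Integration.integral_cong[OF refl g_eq]
          Bochner_Integration.integral_add[OF gl_int s_int])
    show ?thesis
    proof (rule that[of g c])
      show "g \<in> borel_measurable M" unfolding g_def by measurable
      show "0 \<le> g w" for w by (simp add: g_def gl_def gu_def)
      show "conj_fun U c < \<infinity>" by (rule conj_fun_less_top[OF U c_pos])
      show "AE w in M. w \<notin> A \<longrightarrow> conj_opt U (c * Z w) (g w)"
        using gl_opt AE_space by eventually_elim (auto simp: g_def intro: gu_opt)
    qed (use c g_int g_b in auto)
  qed
qed

section \<open>Finiteness of the value, subsequences and existence\<close>

lemma ext_expectation_Uext_bound:
  assumes "f \<in> attainable M Z x0"
  shows "ext_expectation M (\<lambda>w. Uext U (f w)) \<le> ereal ((\<integral>w. v (1 * Z w) \<partial>M) + x0)"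
proof -
  note fD = attainableD[OF assms]
  have [measurable]: "f \<in> borel_measurable M" by (rule fD)
  have "Uext U (f w) \<le> ereal (v (1 * Z w) + Z w * f w)" if "w \<in> space M" for w
    using Uext_le_conj[OF U fD(2)[OF that], of "Z w"] v_eq[of "Z w"] Z_pos[OF that]
    by (simp add: mult.commute)
  then have "ext_expectation M (\<lambda>w. Uext U (f w)) =
      ereal (\<integral>w. v (1 * Z w) + Z w * f w \<partial>M) -
      enn2ereal (\<integral>\<^sup>+ w. e2ennreal (ereal (v (1 * Z w) + Z w * f w) - Uext U (f w)) \<partial>M)"
    using v_integrable[of 1] fD(3) by (intro ext_expectation_eq) auto
  also have "\<dots> \<le> ereal (\<integral>w. v (1 * Z w) + Z w * f w \<partial>M) - 0"
    by (intro ereal_minus_mono) auto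
  also have "\<dots> \<le> ereal ((\<integral>w. v (1 * Z w) \<partial>M) + x0)"
    using v_integrable[of 1] fD(3,4) by simp
  finally show ?thesis .
qed

lemma const_attainable: "(\<lambda>_. x0) \<in> attainable M Z x0"
  using Z_int Z_mean x0 by (intro attainableI) auto

text \<open>The constant \<open>x0\<close> bounds the value below and weak duality at multiplier 1
  bounds it above; a real \<open>u\<close> is what the Lagrangian estimate subtracts.\<close>

lemma maximizing_sequence:
  obtains f u where "\<And>n. f n \<in> attainable M Z x0" "value_fun M Z U x0 = ereal u"
    "(\<lambda>n. ext_expectation M (\<lambda>w. Uext U (f n w))) \<longlonglongrightarrow> ereal u"
proof -
  let ?J = "\<lambda>f. ext_expectation M (\<lambda>w. Uext U (f w))"
  have "ext_expectation M (\<lambda>w. Uext U x0) = ereal (U x0)"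
    using ext_expectation_eq[of "\<lambda>w. Uext U x0" M "\<lambda>w. U x0"] x0 prob_space
    by (simp add: zero_ennreal.rep_eq)
  then have "ereal (U x0) \<le> value_fun M Z U x0"
    unfolding value_fun_def using SUP_upper[OF const_attainable, of ?J] by simp
  moreover have "value_fun M Z U x0 \<le> ereal ((\<integral>w. v (1 * Z w) \<partial>M) + x0)"
    unfolding value_fun_def by (intro SUP_least ext_expectation_Uext_bound)
  ultimately obtain u where u: "value_fun M Z U x0 = ereal u"
    by (cases "value_fun M Z U x0") auto
  have "?J ` attainable M Z x0 \<noteq> {}" using const_attainable by auto
  then obtain F :: "nat \<Rightarrow> ereal" where F: "incseq F" "range F \<subseteq> ?J ` attainable M Z x0"
      "Sup (?J ` attainable M Z x0) = (SUP i. F i)"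
    by (metis Sup_countable_SUP)
  then have "\<forall>n. \<exists>f. f \<in> attainable M Z x0 \<and> F n = ?J f" by auto
  then obtain f where f: "\<And>n. f n \<in> attainable M Z x0" "\<And>n. F n = ?J (f n)" by metis
  have "F \<longlonglongrightarrow> ereal u"
    using LIMSEQ_SUP[OF F(1)] F(3) u by (simp add: value_fun_def)
  moreover have "F = (\<lambda>n. ?J (f n))" using f(2) by (rule ext)
  ultimately show ?thesis using that[of f, OF f(1) u] by simp
qed

text \<open>\<open>B\<close> ranges over all sets: a non-integrable integrand has Bochner integral
  0, which respects both bounds. The diagonal argument receives a bound uniform in
  \<open>B\<close>.\<close>

lemma cost_restrict_bounds:
  assumes "f \<in> attainable M Z x0"
  shows "0 \<le> (\<integral>w. indicator B w * (Z w * f w) \<partial>M)" "(\<integral>w. indicator B w * (Z w * f w) \<partial>M) \<le> x0"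
proof -
  note fD = attainableD[OF assms]
  have nn: "0 \<le> Z w * f w" if "w \<in> space M" for w
    using fD(2)[OF that] by (rule Z_mult_nonneg[OF that])
  then show "0 \<le> (\<integral>w. indicator B w * (Z w * f w) \<partial>M)"
    by (intro Bochner_Integration.integral_nonneg_AE AE_I2) auto
  have "(\<integral>w. indicator B w * (Z w * f w) \<partial>M) \<le> (\<integral>w. Z w * f w \<partial>M)"
    using nn fD(3) by (intro integral_mono') (auto simp: indicator_def)
  then show "(\<integral>w. indicator B w * (Z w * f w) \<partial>M) \<le> x0" using fD(4) by simp
qed

text \<open>On a fibre of \<open>\<phi>\<close> of positive mass every \<open>f n\<close> is a constant, which the budget
  constraint bounds uniformly in \<open>n\<close>; Cantor's diagonal argument handles the countably many
  fibres at once.\<close>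

lemma subsequence_converging_on_atoms:
  assumes f: "\<And>n. f n \<in> attainable M Z x0"
  obtains r :: "nat \<Rightarrow> nat" and A a b and \<phi> :: "'a \<Rightarrow> real" where "strict_mono r" "A \<in> sets M" "\<phi> \<in> borel_measurable M"
    "\<And>w. 0 \<le> \<phi> w" "\<And>w. \<phi> w \<le> 2"
    "\<And>t. emeasure M {w\<in>space M. w \<in> space M - A \<and> \<phi> w = t} = 0"
    "\<And>w. w \<in> A \<Longrightarrow> convergent (\<lambda>n. f (r n) w)"
    "(\<lambda>n. \<integral>w. indicator A w * (Z w * f (r n) w) \<partial>M) \<longlonglongrightarrow> a"
    "(\<lambda>n. \<integral>w. indicator (- A) w * (Z w * f (r n) w) \<partial>M) \<longlonglongrightarrow> b"
proof -
  note fD = attainableD[OF f]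
  obtain \<phi> :: "'a \<Rightarrow> real" where phi [measurable]: "\<phi> \<in> borel_measurable M" and bd: "\<And>w. 0 \<le> \<phi> w" "\<And>w. \<phi> w \<le> 2"
    and sep: "\<And>n w w'. \<phi> w = \<phi> w' \<Longrightarrow> f n w = f n w'"
    by (rule countable_family_code[of f M, OF fD(1)], rule that)
  interpret D: prob_space "distr M borel \<phi>" by (rule prob_space_distr) simp
  define D where "D = {d. measure (distr M borel \<phi>) {d} \<noteq> 0}"
  have D: "countable D" unfolding D_def by (rule D.countable_support)
  define A where "A = \<phi> -` D \<inter> space M"
  have A [measurable]: "A \<in> sets M"
    unfolding A_def by (rule measurable_sets[OF phi], rule sets.countable[OF _ D]) simp
  \<comment> \<open>Costs, unlike the values of \<open>f n\<close>, are bounded by \<open>x0\<close>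
    uniformly, so the diagonal lemma is applied to functions whose points are sets: the countably
    many fibres together with \<open>A\<close> and its complement.\<close>
  define C where "C n B = (\<integral>w. indicator B w * (Z w * f n w) \<partial>M)" for n B
  have "norm (C n B) \<le> x0" for n B
    using cost_restrict_bounds[OF f] by (simp add: C_def)
  moreover have "countable ({A, - A} \<union> (\<lambda>d. \<phi> -` {d}) ` D)" using D by simp
  ultimately obtain r where r: "strict_mono r"
    "\<And>B. B \<in> {A, - A} \<union> (\<lambda>d. \<phi> -` {d}) ` D \<Longrightarrow> \<exists>l. (\<lambda>n. C (r n) B) \<longlonglongrightarrow> l"
    using function_convergent_subsequence[of "{A, - A} \<union> (\<lambda>d. \<phi> -` {d}) ` D" C x0] by metis
  obtain a b where ab: "(\<lambda>n. C (r n) A) \<longlonglongrightarrow> a" "(\<lambda>n. C (r n) (- A)) \<longlonglongrightarrow> b"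
    using r(2)[of A] r(2)[of "- A"] by auto
  show ?thesis
  proof (rule that[of r A \<phi> a b])
    show "emeasure M {w\<in>space M. w \<in> space M - A \<and> \<phi> w = t} = 0" for t
    proof (cases "t \<in> D")
      case True
      then have "{w\<in>space M. w \<in> space M - A \<and> \<phi> w = t} = {}" by (auto simp: A_def)
      then show ?thesis by (simp only: emeasure_empty)
    next
      case False
      then have "emeasure (distr M borel \<phi>) {t} = 0" by (simp add: D_def D.emeasure_eq_measure)
      then have "emeasure M (\<phi> -` {t} \<inter> space M) = 0" by (simp add: emeasure_distr)
      then show ?thesis
        by (rule emeasure_eq_0[rotated]) auto
    qed
    show "convergent (\<lambda>n. f (r n) w)" if w: "w \<in> A" for w
    proof -
      define B where "B = \<phi> -` {\<phi> w}"
      \<comment> \<open>The mass of the fibre under the measure with density Z. As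
        \<open>f n\<close> is constant on the fibre, its cost there is this constant times
        \<open>q\<close>, and q \<noteq> 0 turns convergence of costs into convergence of
        values.\<close>
      define q where "q = (\<integral>w. indicator B w * Z w \<partial>M)"
      have B [measurable]: "B \<inter> space M \<in> sets M" unfolding B_def by measurable
      have "measure M (B \<inter> space M) \<noteq> 0"
        using w by (simp add: A_def D_def B_def measure_distr)
      have q: "q \<noteq> 0"
      proof
        assume "q = 0"
        have i: "integrable M (\<lambda>w. indicator B w * Z w)"
          by (rule Bochner_Integration.integrable_bound[OF Z_int]) (auto simp: indicator_def B_def)
        have "AE w in M. indicator B w * Z w = 0"
          using \<open>q = 0\<close> Z_pos unfolding q_def
          by (subst (asm) integral_nonneg_eq_0_iff_AE[OF i]) (auto simp: less_imp_le)
        then have "AE w in M. w \<notin> B \<inter> space M"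
          using AE_space
        proof eventually_elim
          case (elim w) then show ?case using Z_pos[of w] by (auto simp: indicator_def)
        qed
        moreover have "{w \<in> space M. \<not> w \<notin> B \<inter> space M} = B \<inter> space M" by auto
        ultimately have "emeasure M (B \<inter> space M) = 0"
          by (simp only: AE_iff_measurable[OF B])
        with \<open>measure M (B \<inter> space M) \<noteq> 0\<close> show False by (simp add: measure_def)
      qed
      have "C n B = f n w * q" for n
      proof -
        have "C n B = (\<integral>w'. f n w * (indicator B w' * Z w') \<partial>M)"
          unfolding C_def
        proof (rule Bochner_Integration.integral_cong[OF refl])
          fix w'
          show "indicator B w' * (Z w' * f n w') = f n w * (indicator B w' * Z w')"
            using sep[of w' w n] by (auto simp: B_def indicator_def)
        qed
        then show ?thesis by (simp add: q_def)
      qed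
      moreover have "\<exists>l. (\<lambda>n. C (r n) B) \<longlonglongrightarrow> l" using w by (intro r(2)) (auto simp: A_def B_def)
      ultimately have "convergent (\<lambda>n. f (r n) w * q)" by (simp add: convergent_def)
      then show ?thesis using q by (simp add: convergent_mult_const_right_iff)
    qed
  qed (use r A bd ab in \<open>auto simp: C_def\<close>)
qed

lemma maximizer_exists:
  "\<exists>fhat\<in>attainable M Z x0. value_fun M Z U x0 = ext_expectation M (\<lambda>w. Uext U (fhat w))"
proof -
  obtain f0 u where f0: "\<And>n. f0 n \<in> attainable M Z x0" and u: "value_fun M Z U x0 = ereal u"
    and lim0: "(\<lambda>n. ext_expectation M (\<lambda>w. Uext U (f0 n w))) \<longlonglongrightarrow> ereal u"
    using maximizing_sequence by metis
  obtain r A a b and \<phi> :: "'a \<Rightarrow> real" where r: "strict_mono r" and A [measurable]: "A \<in> sets M"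
    and phi: "\<phi> \<in> borel_measurable M" "\<And>w. 0 \<le> \<phi> w" "\<And>w. \<phi> w \<le> 2"
    "\<And>t. emeasure M {w\<in>space M. w \<in> space M - A \<and> \<phi> w = t} = 0"
    and conv0: "\<And>w. w \<in> A \<Longrightarrow> convergent (\<lambda>n. f0 (r n) w)"
    and a: "(\<lambda>n. \<integral>w. indicator A w * (Z w * f0 (r n) w) \<partial>M) \<longlonglongrightarrow> a"
    and b: "(\<lambda>n. \<integral>w. indicator (- A) w * (Z w * f0 (r n) w) \<partial>M) \<longlonglongrightarrow> b"
    by (rule subsequence_converging_on_atoms[of f0, OF f0], rule that)
  define f where "f n = f0 (r n)" for n
  have f: "f n \<in> attainable M Z x0" for n unfolding f_def by (rule f0)
  note fD = attainableD[OF f]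
  have [measurable]: "f n \<in> borel_measurable M" for n by (rule fD)
  have lim: "(\<lambda>n. ext_expectation M (\<lambda>w. Uext U (f n w))) \<longlonglongrightarrow> ereal u"
    unfolding f_def using LIMSEQ_subseq_LIMSEQ[OF lim0 r] by (simp add: comp_def)
  note a = a[folded f_def] and b = b[folded f_def]
  define l where "l w = max 0 (lim (\<lambda>n. f n w))" for w
  have [measurable]: "l \<in> borel_measurable M" unfolding l_def by measurable
  have l_lim: "(\<lambda>n. f n w) \<longlonglongrightarrow> l w" if "w \<in> A" for w
  proof -
    have ww: "w \<in> space M" using that sets.sets_into_space[OF A] by auto
    have "(\<lambda>n. f n w) \<longlonglongrightarrow> lim (\<lambda>n. f n w)"
      using conv0[OF that] by (simp add: f_def convergent_LIMSEQ_iff)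
    moreover from this have "0 \<le> lim (\<lambda>n. f n w)" using fD(2)[OF ww] by (auto intro: LIMSEQ_le_const)
    ultimately show ?thesis by (simp add: l_def)
  qed
  have b_nn: "0 \<le> b"
    using cost_restrict_bounds(1)[OF f] by (intro LIMSEQ_le_const[OF b]) auto
  have f_intB: "integrable M (\<lambda>w. indicator (- A) w * (Z w * f n w))" for n
    by (rule Bochner_Integration.integrable_bound[OF fD(3)[of n]]) (auto simp: indicator_def)
  have "\<exists>g. g \<in> attainable M Z x0 \<and> ereal u \<le> ext_expectation M (\<lambda>w. Uext U (g w))"
  proof (cases "b = 0")
    case False
    then have b_pos: "0 < b" using b_nn by simp
    \<comment> \<open>Cost that persists off \<open>A\<close> needs a set of positive mass; for c =
      0, \<open>optimal_allocation\<close> draws a point from it.\<close>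
    have pos: "\<not> (AE w in M. w \<in> A)"
    proof
      assume AE: "AE w in M. w \<in> A"
      have "(\<integral>w. indicator (- A) w * (Z w * f n w) \<partial>M) = 0" for n
        using AE by (intro integral_eq_zero_AE) (auto elim!: eventually_mono)
      then have "b = 0" using LIMSEQ_unique[OF b] by simp
      with False show False ..
    qed
    obtain g c where g: "g \<in> borel_measurable M" "\<And>w. 0 \<le> g w" "0 \<le> c" "conj_fun U c < \<infinity>"
      "AE w in M. w \<notin> A \<longrightarrow> conj_opt U (c * Z w) (g w)"
      "integrable M (\<lambda>w. indicator (- A) w * (Z w * g w))"
      "(\<integral>w. indicator (- A) w * (Z w * g w) \<partial>M) \<le> b"
      "c * (\<integral>w. indicator (- A) w * (Z w * g w) \<partial>M) = c * b"
      by (rule optimal_allocation[OF A phi pos b_pos], rule that)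
    define h where "h w = (if w \<in> A then l w else g w)" for w
    have hg: "indicator (- A) w * (Z w * h w) = indicator (- A) w * (Z w * g w)" for w
      by (auto simp: h_def indicator_def)
    have "h \<in> attainable M Z x0 \<and> ereal u \<le> ext_expectation M (\<lambda>w. Uext U (h w))"
    proof (rule limit_of_maximizing_sequence[OF f lim A a b])
      show "h \<in> borel_measurable M" unfolding h_def using g(1) by measurable
      show "0 \<le> h w" for w using g(2) by (simp add: h_def l_def)
      show "AE w in M. w \<in> A \<longrightarrow> (\<lambda>n. f n w) \<longlonglongrightarrow> h w" using l_lim by (simp add: h_def)
      show "AE w in M. w \<notin> A \<longrightarrow> conj_opt U (c * Z w) (h w)"
        using g(5) by eventually_elim (simp add: h_def)
    qed (use g in \<open>simp_all add: hg\<close>)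
    then show ?thesis by blast
  next
    case True
    \<comment> \<open>Without a budget off \<open>A\<close> the costs there tend to 0 in L1, so
      along a subsequence \<open>f\<close> tends to 0 almost everywhere because Z > 0. The sequence
      now converges on all of \<open>space M\<close>, which takes the place of
      \<open>A\<close>.\<close>
    have "(\<lambda>n. \<integral>w. norm (indicator (- A) w * (Z w * f n w)) \<partial>M) \<longlonglongrightarrow> 0"
    proof -
      have "(\<integral>w. norm (indicator (- A) w * (Z w * f n w)) \<partial>M) =
          (\<integral>w. indicator (- A) w * (Z w * f n w) \<partial>M)" for n
        using Z_pos fD(2)
        by (intro Bochner_Integration.integral_cong) (auto simp: abs_mult indicator_def abs_of_pos)
      then show ?thesis using b True by simp
    qed
    then obtain s where s: "strict_mono s"
      "AE w in M. (\<lambda>n. indicator (- A) w * (Z w * f (s n) w)) \<longlonglongrightarrow> 0"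
      using tendsto_L1_AE_subseq[of M "\<lambda>n w. indicator (- A) w * (Z w * f n w)", OF f_intB] by blast
    define h where "h w = (if w \<in> A then l w else 0)" for w
    have "h \<in> attainable M Z x0 \<and> ereal u \<le> ext_expectation M (\<lambda>w. Uext U (h w))"
    proof (rule limit_of_maximizing_sequence[where c = 1 and b = 0 and A = "space M" and f = "\<lambda>n. f (s n)"])
      show "(\<lambda>n. ext_expectation M (\<lambda>w. Uext U (f (s n) w))) \<longlonglongrightarrow> ereal u"
        using LIMSEQ_subseq_LIMSEQ[OF lim s(1)] by (simp add: comp_def)
      have "(\<integral>w. indicator (space M) w * (Z w * f n w) \<partial>M) =
          (\<integral>w. indicator A w * (Z w * f n w) \<partial>M) + (\<integral>w. indicator (- A) w * (Z w * f n w) \<partial>M)" for n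
      proof -
        have f_intA: "integrable M (\<lambda>w. indicator A w * (Z w * f n w))"
          by (rule Bochner_Integration.integrable_bound[OF fD(3)[of n]]) (auto simp: indicator_def)
        show ?thesis
          by (subst Bochner_Integration.integral_add[symmetric, OF f_intA f_intB])
            (auto intro!: Bochner_Integration.integral_cong simp: indicator_def)
      qed
      then have "(\<lambda>n. \<integral>w. indicator (space M) w * (Z w * f n w) \<partial>M) \<longlonglongrightarrow> a + b"
        using tendsto_add[OF a b] by simp
      from LIMSEQ_subseq_LIMSEQ[OF this s(1)]
      show "(\<lambda>n. \<integral>w. indicator (space M) w * (Z w * f (s n) w) \<partial>M) \<longlonglongrightarrow> a + b"
        by (simp add: comp_def)
      have z: "(\<integral>w. indicator (- space M) w * k w \<partial>M) = 0" for k :: "'a \<Rightarrow> real"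
        by (intro integral_eq_zero_AE AE_I2) auto
      show "(\<lambda>n. \<integral>w. indicator (- space M) w * (Z w * f (s n) w) \<partial>M) \<longlonglongrightarrow> 0"
        by (simp add: z)
      show "(\<integral>w. indicator (- space M) w * (Z w * h w) \<partial>M) \<le> 0"
        "1 * (\<integral>w. indicator (- space M) w * (Z w * h w) \<partial>M) = 1 * 0"
        by (simp_all add: z)
      show "integrable M (\<lambda>w. indicator (- space M) w * (Z w * h w))"
        by (subst Bochner_Integration.integrable_cong[OF refl, of _ _ "\<lambda>_. 0"]) auto
      show "h \<in> borel_measurable M" unfolding h_def by measurable
      show "AE w in M. w \<in> space M \<longrightarrow> (\<lambda>n. f (s n) w) \<longlonglongrightarrow> h w"
        using s(2)
      proof eventually_elim
        case (elim w)
        show ?case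
        proof
          assume w: "w \<in> space M"
          show "(\<lambda>n. f (s n) w) \<longlonglongrightarrow> h w"
          proof (cases "w \<in> A")
            case True
            then show ?thesis
              using LIMSEQ_subseq_LIMSEQ[OF l_lim[OF True] s(1)] by (simp add: h_def comp_def)
          next
            case False
            then have "(\<lambda>n. Z w * f (s n) w) \<longlonglongrightarrow> 0" using elim by simp
            then have "(\<lambda>n. f (s n) w) \<longlonglongrightarrow> 0"
              using tendsto_mult[OF tendsto_const, of "\<lambda>n. Z w * f (s n) w" 0 sequentially "1 / Z w"] Z_pos[OF w]
              by simp
            then show ?thesis using False by (simp add: h_def)
          qed
        qed
      qed
      show "conj_fun U 1 < \<infinity>" by (rule conj_fun_less_top[OF U]) simp
    qed (auto simp: f h_def l_def)
    then show ?thesis by blast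
  qed
  then obtain g where g: "g \<in> attainable M Z x0" "ereal u \<le> ext_expectation M (\<lambda>w. Uext U (g w))"
    by blast
  moreover have "ext_expectation M (\<lambda>w. Uext U (g w)) \<le> value_fun M Z U x0"
    unfolding value_fun_def using g(1) by (rule SUP_upper)
  ultimately show ?thesis using u by (intro bexI[of _ g]) auto
qed

end

theorem theorem3p3:
  fixes M :: "'a measure" and Z :: "'a \<Rightarrow> real" and U :: "real \<Rightarrow> real" and x0 :: real
  assumes "prob_space M"
    and "Z \<in> borel_measurable M"
    and "\<forall>w\<in>space M. Z w > 0"
    and "integrable M Z" and "(\<integral>w. Z w \<partial>M) = 1"
    and "utility U"
    and "\<forall>y>0. ext_expectation M (\<lambda>w. conj_fun U (y * Z w)) < \<infinity>"
    and "x0 > 0"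
  shows "\<exists>fhat\<in>attainable M Z x0.
           value_fun M Z U x0 = ext_expectation M (\<lambda>w. Uext U (fhat w))"
proof -
  interpret prob_space M by fact
  interpret utility_problem M Z U x0
    using assms by unfold_locales auto
  show ?thesis by (rule maximizer_exists)
qed

end
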